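(* Let $\chi$ be the character of $\mathrm{SL}_2(\mathbf{Z})$ attached to $\eta^2$, let $a\in\{0,\dots,11\}$, $t\in\mathbf{Z}$, and let $L=\frac{a}{12}+t$ (an exponent for $\chi^a$). Then for all integers $k$ there is a canonical isomorphism of line bundles \[\overline{\mathcal{V}}_{k,L}(\chi^a)\cong\overline{\mathcal{L}}_{k-a-12t}.\]
   Context: $\eta$ is the Dedekind eta function; $\chi$ is the character with $\chi(T)=e^{2\pi i/12}$, $\chi(S)=-i$, where $T=\begin{pmatrix}1&1\\0&1\end{pmatrix}$, $S=\begin{pmatrix}0&-1\\1&0\end{pmatrix}$; so $\eta^2(\gamma\tau)=(c\tau+d)\chi(\gamma)\eta^2(\tau)$. Let $\mathfrak{h}$ be the upper half-plane, $\mathcal{M}^{\mathrm{an}}=[\mathrm{SL}_2(\mathbf{Z})\backslash\mathfrak{h}]$ (orbifold quotient), and $\overline{\mathcal{M}}^{\mathrm{an}}$ the compactified modular orbifold obtained by gluing $\mathcal{M}^{\mathrm{an}}$ and $[C_2\backslash\mathbf{D}]$ ($\mathbf{D}$ the unit disk, $C_2=\{\pm1\}$ acting trivially) along $[\langle -I_2,T\rangle\backslash\mathfrak{h}]\cong[C_2\backslash\mathbf{D}^\times]$ via $\tau\mapsto e^{2\pi i\tau}$. For $\rho:\mathrm{SL}_2(\mathbf{Z})\to\mathrm{GL}(V)$ and an endomorphism $L$ of $V$ with $\rho(T)=e^{2\pi iL}$, $\overline{\mathcal{V}}_{k,L}(\rho)$ is the vector bundle on $\overline{\mathcal{M}}^{\mathrm{an}}$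 obtained by gluing $[\mathrm{SL}_2(\mathbf{Z})\backslash(V\times\mathfrak{h})]$ (action $\gamma(v,\tau)=((c\tau+d)^k\rho(\gamma)v,\gamma\tau)$) with $[C_2\backslash(V\times\mathbf{D})]$ ($\pm1$ acting by $(\pm1)^k\rho(\pm I_2)$) via $(v,\tau)\mapsto(e^{-2\pi i\tau L}v,e^{2\pi i\tau})$. $\overline{\mathcal{L}}_k=\overline{\mathcal{V}}_{k,0}(\mathbf{1})$ for the trivial representation $\mathbf{1}$ (line bundle of level one weight $k$ holomorphic modular forms). *)

theory Defs
  imports "HOL-Analysis.Analysis" "HOL-Algebra.Generated_Groups"
begin

section \<open>The groups and their actions\<close>

definition upper_half_plane :: "complex set" where
  "upper_half_plane = {\<tau>. Im \<tau> > 0}"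

abbreviation unit_disk :: "complex set" where
  "unit_disk \<equiv> ball 0 1"

definition SL2Z :: "(int^2^2) monoid" where
  "SL2Z = \<lparr>carrier = {\<gamma>. det \<gamma> = 1}, monoid.mult = (**), one = mat 1\<rparr>"

definition T_mat :: "int^2^2" where
  "T_mat = vector [vector [1, 1], vector [0, 1]]"

definition S_mat :: "int^2^2" where
  "S_mat = vector [vector [0, -1], vector [1, 0]]"

definition C2 :: "int monoid" where
  "C2 = \<lparr>carrier = {1, -1}, monoid.mult = (*), one = 1\<rparr>"

definition nonzero_complex :: "complex monoid" where
  "nonzero_complex = \<lparr>carrier = UNIV - {0}, monoid.mult = (*), one = 1\<rparr>"

definition GL :: "(complex^'n^'n) monoid" where
  "GL = \<lparr>carrier = {A. invertible A}, monoid.mult = (**), one = mat 1\<rparr>"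

definition modular_action :: "int^2^2 \<Rightarrow> complex \<Rightarrow> complex" where
  "modular_action \<gamma> =
     moebius (of_int (\<gamma>$1$1)) (of_int (\<gamma>$1$2)) (of_int (\<gamma>$2$1)) (of_int (\<gamma>$2$2))"

definition autfactor :: "int^2^2 \<Rightarrow> complex \<Rightarrow> complex" where
  "autfactor \<gamma> \<tau> = of_int (\<gamma>$2$1) * \<tau> + of_int (\<gamma>$2$2)"

definition nome :: "complex \<Rightarrow> complex" where
  "nome \<tau> = exp (2 * of_real pi * \<i> * \<tau>)"

section \<open>The eta function and the character of its square\<close>

definition dedekind_eta :: "complex \<Rightarrow> complex" where
  "dedekind_eta \<tau> = exp (2 * of_real pi * \<i> * \<tau> / 24) * prodinf (\<lambda>n. 1 - nome \<tau> ^ Suc n)"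

text \<open>As \<open>S\<close> and \<open>T\<close> generate the modular group, this determines \<open>chi\<close> on the carrier
  of \<open>SL2Z\<close>; its values elsewhere are irrelevant.\<close>

definition eta_squared_character :: "(int^2^2 \<Rightarrow> complex) \<Rightarrow> bool" where
  "eta_squared_character chi \<longleftrightarrow>
     chi \<in> hom SL2Z nonzero_complex \<and>
     chi T_mat = exp (2 * of_real pi * \<i> / 12) \<and> chi S_mat = - \<i>"

section \<open>Exponents\<close>

text \<open>The componentwise product of \<open>'a^'n\<close> prevents using the library's \<open>exp\<close> for matrices.\<close>

definition matrix_exp :: "complex^'n^'n \<Rightarrow> complex^'n^'n" where
  "matrix_exp A = (\<Sum>j. (1 / fact j) *\<^sub>R (((**) A ^^ j) (mat 1)))"

text \<open>\<open>exp_scaled z L\<close> is $e^{2\pi i z L}$.\<close>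

definition exp_scaled :: "complex \<Rightarrow> complex^'n^'n \<Rightarrow> complex^'n^'n" where
  "exp_scaled z L = matrix_exp (mat (2 * of_real pi * \<i> * z) ** L)"

definition exponent :: "(int^2^2 \<Rightarrow> complex^'n^'n) \<Rightarrow> complex^'n^'n \<Rightarrow> bool" where
  "exponent \<rho> L \<longleftrightarrow> \<rho> \<in> hom SL2Z GL \<and> \<rho> T_mat = exp_scaled 1 L"

section \<open>Holomorphic vector bundles on the compactified modular orbifold\<close>

text \<open>Total spaces are \<open>V \<times> X\<close> with \<open>V = complex^'n\<close>. The charts used below are the upper
  half-plane and the unit disk, on which every holomorphic vector bundle is trivial, so that
  product total spaces are no restriction.\<close>

type_synonym 'n total = "(complex^'n) \<times> complex"

text \<open>Holomorphic map of total spaces over \<open>X\<close>, covering \<open>f\<close> on the base, and a linear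
  isomorphism on each fibre.\<close>

definition bundle_iso_over ::
  "complex set \<Rightarrow> (complex \<Rightarrow> complex) \<Rightarrow> ('n::finite total \<Rightarrow> 'm::finite total) \<Rightarrow> bool" where
  "bundle_iso_over X f F \<longleftrightarrow>
     (\<exists>A :: complex \<Rightarrow> complex^'n^'m.
        (\<forall>i j. (\<lambda>x. A x $ i $ j) holomorphic_on X) \<and>
        (\<forall>x\<in>X. invertible (A x)) \<and>
        (\<forall>x\<in>X. \<forall>v. F (v, x) = (A x *v v, f x)))"

text \<open>Holomorphic vector bundle on the orbifold quotient of \<open>X\<close> by \<open>G\<close>, where \<open>G\<close> acts
  on \<open>X\<close> through \<open>\<alpha>\<close>: a lift of the action to the total space.\<close>

definition equivariant_bundle ::
  "'g monoid \<Rightarrow> complex set \<Rightarrow> ('g \<Rightarrow> complex \<Rightarrow> complex) \<Rightarrow> ('g \<Rightarrow> 'n::finite total \<Rightarrow> 'n total) \<Rightarrow> bool"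
  where
  "equivariant_bundle G X \<alpha> act \<longleftrightarrow>
     (\<forall>g\<in>carrier G. bundle_iso_over X (\<alpha> g) (act g)) \<and>
     (\<forall>p\<in>UNIV \<times> X. act \<one>\<^bsub>G\<^esub> p = p) \<and>
     (\<forall>g\<in>carrier G. \<forall>h\<in>carrier G. \<forall>p\<in>UNIV \<times> X. act (g \<otimes>\<^bsub>G\<^esub> h) p = act g (act h p))"

definition equivariant_iso ::
  "'g monoid \<Rightarrow> complex set \<Rightarrow> ('g \<Rightarrow> 'n::finite total \<Rightarrow> 'n total) \<Rightarrow> ('g \<Rightarrow> 'm::finite total \<Rightarrow> 'm total) \<Rightarrow>
   ('n total \<Rightarrow> 'm total) \<Rightarrow> bool" where
  "equivariant_iso G X act act' F \<longleftrightarrow>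
     bundle_iso_over X (\<lambda>x. x) F \<and>
     (\<forall>g\<in>carrier G. \<forall>p\<in>UNIV \<times> X. F (act g p) = act' g (F p))"

text \<open>The group generated by \<open>-I\<close> and \<open>T\<close> consists of the matrices \<open>\<plusminus>T^n\<close>, and the lower right
  entry is the homomorphism to \<open>C2\<close> underlying the identification of its quotient of the
  half-plane with the \<open>C2\<close>-quotient of the punctured disk.\<close>

definition cusp_group :: "(int^2^2) set" where
  "cusp_group = generate SL2Z {mat (-1), T_mat}"

record ('n::finite) mbar_bundle =
  act_half_plane :: "int^2^2 \<Rightarrow> 'n total \<Rightarrow> 'n total"
  act_disk :: "int \<Rightarrow> 'n total \<Rightarrow> 'n total"
  glue :: "'n total \<Rightarrow> 'n total"

definition vector_bundle_on_mbar :: "'n::finite mbar_bundle \<Rightarrow> bool" where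
  "vector_bundle_on_mbar E \<longleftrightarrow>
     equivariant_bundle SL2Z upper_half_plane modular_action (act_half_plane E) \<and>
     equivariant_bundle C2 unit_disk (\<lambda>_ q. q) (act_disk E) \<and>
     bundle_iso_over upper_half_plane nome (glue E) \<and>
     (\<forall>\<gamma>\<in>cusp_group. \<forall>p\<in>UNIV \<times> upper_half_plane.
        glue E (act_half_plane E \<gamma> p) = act_disk E (\<gamma>$2$2) (glue E p))"

text \<open>An isomorphism consists of its components over the two charts, compatible with gluing.\<close>

definition mbar_bundle_iso ::
  "'n::finite mbar_bundle \<Rightarrow> 'm::finite mbar_bundle \<Rightarrow> ('n total \<Rightarrow> 'm total) \<Rightarrow> ('n total \<Rightarrow> 'm total) \<Rightarrow> bool" where
  "mbar_bundle_iso E E' \<Phi> \<Psi> \<longleftrightarrow>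
     equivariant_iso SL2Z upper_half_plane (act_half_plane E) (act_half_plane E') \<Phi> \<and>
     equivariant_iso C2 unit_disk (act_disk E) (act_disk E') \<Psi> \<and>
     (\<forall>p\<in>UNIV \<times> upper_half_plane. glue E' (\<Phi> p) = \<Psi> (glue E p))"

definition Vbar ::
  "int \<Rightarrow> complex^'n^'n \<Rightarrow> (int^2^2 \<Rightarrow> complex^'n^'n) \<Rightarrow> 'n mbar_bundle" where
  "Vbar k L \<rho> =
     \<lparr>act_half_plane =
        (\<lambda>\<gamma> (v, \<tau>). ((autfactor \<gamma> \<tau> powi k) *s (\<rho> \<gamma> *v v), modular_action \<gamma> \<tau>)),
      act_disk = (\<lambda>\<epsilon> (v, q). ((of_int \<epsilon> powi k) *s (\<rho> (mat \<epsilon>) *v v), q)),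
      glue = (\<lambda>(v, \<tau>). (exp_scaled (- \<tau>) L *v v, nome \<tau>))\<rparr>"

definition Lbar :: "int \<Rightarrow> 1 mbar_bundle" where
  "Lbar k = Vbar k 0 (\<lambda>_. mat 1)"

text \<open>A character as a representation on \<open>complex^1\<close>.\<close>

definition char_rep :: "(int^2^2 \<Rightarrow> complex) \<Rightarrow> int^2^2 \<Rightarrow> complex^1^1" where
  "char_rep c \<gamma> = mat (c \<gamma>)"

end

theory Submission
  imports Defs "HOL-Complex_Analysis.Conformal_Mappings"
begin

text \<open>
  With \<open>m = a + 12t\<close>, the transformation law
  \<open>\<eta>(\<gamma>\<tau>)\<^sup>2 = (c\<tau> + d) \<chi>(\<gamma>) \<eta>(\<tau>)\<^sup>2\<close> and \<open>\<chi>\<^sup>1\<^sup>2 = 1\<close> make multiplication by the nowhere vanishing function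
  \<open>\<eta>\<close> to the power \<open>-2m\<close> equivariant from weight \<open>k\<close> and character \<open>\<chi>\<close> to the power \<open>a\<close> to weight
  \<open>k - m\<close> and the trivial character. Since \<open>\<eta>(\<tau>) = exp(2\<pi>i\<tau>/24) P(exp(2\<pi>i\<tau>))\<close> with
  \<open>P(q) = \<Prod>(1 - q^n)\<close> holomorphic and nonvanishing on the unit disk, this map extends over the
  cusp as multiplication by \<open>P\<close> to the power \<open>-2m\<close>.

  The law for \<open>S\<close> follows by analytic continuation from the imaginary axis. There
  \<open>- ln P\<close> is the Lambert series of \<open>1 / (m (exp(2\<pi>my) - 1))\<close>, which by the partial
  fractions of \<open>coth\<close> becomes a double series of \<open>y / (n\<^sup>2 + m\<^sup>2y\<^sup>2)\<close> up to elementary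
  terms. The substitution \<open>y \<mapsto> 1/y\<close> exchanges \<open>m\<close> and \<open>n\<close>, so the two double series cancel on the
  squares \<open>m, n \<le> M\<close>, and what remains outside, a difference of Riemann sums of
  \<open>arctan u / u\<close>, contributes the term \<open>ln y / 2\<close>.
\<close>

section \<open>Partial fractions of the hyperbolic cotangent\<close>

text \<open>Logarithmic differentiation of Euler's reflection formula for
  \<open>Gamma z * Gamma (1 - z)\<close>: the product is differentiated once through
  \<open>Digamma\<close> and once as \<pi> / sin(\<pi>z), and the two derivatives must
  agree.\<close>

lemma Digamma_reflection:
  fixes z :: complex
  assumes "z \<notin> \<int>"
  shows "Digamma (1 - z) - Digamma z = of_real pi * cot (of_real pi * z)"
proof -
  have z1: "z \<notin> \<int>\<^sub>\<le>\<^sub>0" and z2: "1 - z \<notin> \<int>\<^sub>\<le>\<^sub>0"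
    using assms Ints_diff[OF Ints_1, of "1 - z"] by (auto dest: nonpos_Ints_Int)
  have nz: "sin (of_real pi * z) \<noteq> 0"
    using assms by (auto simp: sin_eq_0 mult.commute)
  let ?G = "\<lambda>z. Gamma z * Gamma (1 - z) :: complex"
  have "(?G has_field_derivative (?G z * (Digamma z - Digamma (1 - z)))) (at z)"
    using z1 z2 by (auto intro!: derivative_eq_intros simp: algebra_simps)
  moreover have "?G = (\<lambda>z. of_real pi / sin (of_real pi * z))"
    by (simp add: fun_eq_iff Gamma_reflection_complex)
  moreover have "((\<lambda>z. of_real pi / sin (of_real pi * z)) has_field_derivative
      - (?G z * (of_real pi * cot (of_real pi * z)))) (at z)"
    using nz by (auto intro!: derivative_eq_intros
        simp: Gamma_reflection_complex cot_def field_simps power2_eq_square)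
  ultimately have "?G z * (Digamma z - Digamma (1 - z)) = - (?G z * (of_real pi * cot (of_real pi * z)))"
    by (metis DERIV_unique)
  moreover have "?G z \<noteq> 0"
    using nz by (simp add: Gamma_reflection_complex)
  ultimately have "Digamma z - Digamma (1 - z) = - (of_real pi * cot (of_real pi * z))"
    by (metis mult_left_cancel mult_minus_right)
  then show ?thesis
    by (simp add: algebra_simps)
qed

text \<open>The left side is the difference of the series of \<open>Digamma (1 + z)\<close> and
  \<open>Digamma (1 - z)\<close>, in which the harmonic terms and the Euler constant cancel. The
  recurrence moves \<open>1 + z\<close> back to \<open>z\<close>, and reflection supplies the
  cotangent.\<close>

lemma cot_partial_fractions:
  fixes z :: complex
  assumes "z \<notin> \<int>"
  shows "(\<lambda>k. 1 / (of_nat (Suc k) - z) - 1 / (of_nat (Suc k) + z)) sums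
           (1 / z - of_real pi * cot (of_real pi * z))"
proof -
  have "z \<noteq> 0" "1 - z \<noteq> 0" "1 + z \<noteq> 0"
    using assms by (auto simp: add_eq_0_iff)
  have D: "(\<lambda>k. inverse (of_nat (Suc k)) - inverse (w + of_nat k)) sums (Digamma w + euler_mascheroni)"
    if "w \<noteq> 0" for w :: complex
    using summable_sums[OF summable_Digamma[OF that]] by (simp add: Digamma_def)
  have "(\<lambda>k. (inverse (of_nat (Suc k)) - inverse ((1 + z) + of_nat k)) -
      (inverse (of_nat (Suc k)) - inverse ((1 - z) + of_nat k))) sums
      ((Digamma (1 + z) + euler_mascheroni) - (Digamma (1 - z) + euler_mascheroni))"
    by (intro sums_diff D) fact+
  moreover have "Digamma (1 + z) = Digamma z + 1 / z"
    using Digamma_plus1[OF \<open>z \<noteq> 0\<close>] by (simp add: add.commute)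
  ultimately show ?thesis
    using Digamma_reflection[OF assms] by (simp add: algebra_simps divide_inverse)
qed

text \<open>The expansion of the cotangent at \<open>z = \<i> * x\<close>, divided by
  \<open>2 * \<i>\<close>. The right side is \<pi>/2 coth(\<pi>x) - 1/(2x), written with the
  exponential that occurs in the Lambert series.\<close>

lemma coth_partial_fractions:
  fixes x :: real
  assumes "x > 0"
  shows "(\<lambda>n. x / (real (Suc n) ^ 2 + x ^ 2)) sums
           (pi / 2 + pi / (exp (2 * pi * x) - 1) - 1 / (2 * x))"
proof -
  define z where "z = \<i> * of_real x"
  have "z \<notin> \<int>"
    using assms by (auto simp: z_def complex_eq_iff elim!: Ints_cases)
  have s: "exp (2 * pi * x) > 1"
    using assms by simp
  have e: "exp (2 * pi * x) = exp (pi * x) ^ 2"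
    by (simp add: exp_double [symmetric] mult.assoc)
  have p: "exp (pi * x) ^ 2 > 1"
    using s e by simp
  have "cot (of_real pi * z) = - \<i> * of_real ((exp (pi * x) + exp (- (pi * x))) / (exp (pi * x) - exp (- (pi * x))))"
  proof -
    have "of_real pi * z = \<i> * of_real (pi * x)"
      by (simp add: z_def)
    moreover have "exp (- (\<i> * (\<i> * of_real (pi * x)))) = (of_real (exp (pi * x)) :: complex)"
      "exp (\<i> * (\<i> * of_real (pi * x))) = (of_real (exp (- (pi * x))) :: complex)"
      by (simp_all add: exp_of_real[symmetric] mult.assoc[symmetric])
    ultimately show ?thesis
      unfolding cot_def sin_exp_eq cos_exp_eq
      by (simp del: of_real_mult add: divide_simps) (simp add: algebra_simps)
  qed
  also have "(exp (pi * x) + exp (- (pi * x))) / (exp (pi * x) - exp (- (pi * x))) = 1 + 2 / (exp (2 * pi * x) - 1)"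
    using p unfolding e exp_minus by (simp add: field_simps power2_eq_square)
  finally have cot: "cot (of_real pi * z) = - \<i> * of_real (1 + 2 / (exp (2 * pi * x) - 1))" .
  have t: "1 / (of_nat (Suc k) - z) - 1 / (of_nat (Suc k) + z) = 2 * \<i> * of_real (x / (real (Suc k) ^ 2 + x ^ 2))" for k
  proof -
    have "of_nat (Suc k) - z \<noteq> 0" "of_nat (Suc k) + z \<noteq> 0"
      using \<open>x > 0\<close> by (auto simp: z_def complex_eq_iff)
    then have "1 / (of_nat (Suc k) - z) - 1 / (of_nat (Suc k) + z) = 2 * z / (of_nat (Suc k) ^ 2 - z ^ 2)"
      by (simp add: field_simps power2_eq_square)
    also have "of_nat (Suc k) ^ 2 - z ^ 2 = of_real (real (Suc k) ^ 2 + x ^ 2)"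
      by (simp add: z_def power_mult_distrib)
    finally show ?thesis
      by (simp add: z_def)
  qed
  have "(\<lambda>k. 2 * \<i> * of_real (x / (real (Suc k) ^ 2 + x ^ 2))) sums
      (1 / z - of_real pi * cot (of_real pi * z))"
    using cot_partial_fractions[OF \<open>z \<notin> \<int>\<close>] unfolding t .
  also have "1 / z - of_real pi * cot (of_real pi * z) =
      2 * \<i> * of_real (pi / 2 + pi / (exp (2 * pi * x) - 1) - 1 / (2 * x))"
    using assms s unfolding cot by (simp add: z_def field_simps)
  finally have "(\<lambda>k. of_real (x / (real (Suc k) ^ 2 + x ^ 2)) :: complex) sums
      of_real (pi / 2 + pi / (exp (2 * pi * x) - 1) - 1 / (2 * x))"
    by (subst (asm) sums_mult_iff) auto
  then show ?thesis
    by (subst (asm) sums_of_real_iff)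
qed

section \<open>Inversion of the Lambert series\<close>

lemma integral_antimono_bounds:
  fixes f :: "real \<Rightarrow> real"
  assumes "a \<le> b" "continuous_on {a..b} f" and anti: "\<And>s t. a \<le> s \<Longrightarrow> s \<le> t \<Longrightarrow> t \<le> b \<Longrightarrow> f t \<le> f s"
  shows "(b - a) * f b \<le> integral {a..b} f" "integral {a..b} f \<le> (b - a) * f a"
proof -
  have int: "f integrable_on {a..b}"
    using assms by (intro integrable_continuous_interval)
  have "integral {a..b} (\<lambda>_. f b) \<le> integral {a..b} f"
    using anti assms(1) by (intro integral_le int integrable_const_ivl) auto
  moreover have "integral {a..b} f \<le> integral {a..b} (\<lambda>_. f a)"
    using anti assms(1) by (intro integral_le int integrable_const_ivl) auto
  ultimately show "(b - a) * f b \<le> integral {a..b} f" "integral {a..b} f \<le> (b - a) * f a"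
    using assms(1) by simp_all
qed

text \<open>For a decreasing function the integral lies between the sums over right and left
  endpoints. These differ only in their end terms, by \<open>y / M * (f 0 - f y)\<close>, which
  tends to 0.\<close>

lemma Riemann_sum_antimono:
  fixes f :: "real \<Rightarrow> real"
  assumes "0 \<le> y" and cont: "continuous_on {0..y} f"
    and anti: "\<And>s t. 0 \<le> s \<Longrightarrow> s \<le> t \<Longrightarrow> t \<le> y \<Longrightarrow> f t \<le> f s"
  shows "(\<lambda>M. \<Sum>m<M. y / real M * f (y * real (Suc m) / real M)) \<longlonglongrightarrow> integral {0..y} f"
proof -
  define R where "R M = (\<Sum>m<M. y / real M * f (y * real (Suc m) / real M))" for M
  define G where "G x = integral {0..x} f" for x
  have bounds: "R M \<le> G y \<and> G y \<le> R M + y / real M * (f 0 - f y)" if "M > 0" for M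
  proof -
    define p where "p m = y * real m / real M" for m :: nat
    have p: "0 \<le> p m" "p m \<le> p (Suc m)" "p (Suc m) - p m = y / real M" for m
      using \<open>0 \<le> y\<close> \<open>M > 0\<close> by (auto simp: p_def field_simps mult_left_mono)
    have p_le: "p m \<le> y" if "m \<le> M" for m
      using \<open>0 \<le> y\<close> \<open>M > 0\<close> that by (simp add: p_def field_simps mult_left_mono)
    have pM: "p M = y" "p 0 = 0"
      using \<open>M > 0\<close> by (simp_all add: p_def)
    have split: "G (p (Suc m)) - G (p m) = integral {p m..p (Suc m)} f" if "m < M" for m
    proof -
      have "integral {0..p m} f + integral {p m..p (Suc m)} f = integral {0..p (Suc m)} f"
        using p p_le[of "Suc m"] that
        by (intro Henstock_Kurzweil_Integration.integral_combine integrable_continuous_interval continuous_on_subset[OF cont]) auto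
      then show ?thesis
        by (simp add: G_def)
    qed
    have est: "y / real M * f (p (Suc m)) \<le> G (p (Suc m)) - G (p m)"
      "G (p (Suc m)) - G (p m) \<le> y / real M * f (p m)" if "m < M" for m
    proof -
      have c: "continuous_on {p m..p (Suc m)} f"
        using p[of m] p_le[of "Suc m"] that by (intro continuous_on_subset[OF cont]) auto
      have anti': "f t \<le> f s" if "p m \<le> s" "s \<le> t" "t \<le> p (Suc m)" for s t
        using that p(1)[of m] p_le[of "Suc m"] \<open>m < M\<close> by (intro anti) auto
      have "(p (Suc m) - p m) * f (p (Suc m)) \<le> integral {p m..p (Suc m)} f"
        by (rule integral_antimono_bounds(1)[OF p(2) c anti'])
      moreover have "integral {p m..p (Suc m)} f \<le> (p (Suc m) - p m) * f (p m)"
        by (rule integral_antimono_bounds(2)[OF p(2) c anti'])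
      ultimately show "y / real M * f (p (Suc m)) \<le> G (p (Suc m)) - G (p m)"
        "G (p (Suc m)) - G (p m) \<le> y / real M * f (p m)"
        using split[OF that] p(3)[of m] by auto
    qed
    have tel: "(\<Sum>m<M. G (p (Suc m)) - G (p m)) = G y"
      by (subst sum_lessThan_telescope) (simp add: pM, simp add: G_def)
    have "R M \<le> G y"
      unfolding tel[symmetric] R_def by (intro sum_mono) (use est in \<open>auto simp: p_def\<close>)
    moreover have "G y \<le> (\<Sum>m<M. y / real M * f (p m))"
      unfolding tel[symmetric] by (intro sum_mono) (use est in auto)
    moreover have "(\<Sum>m<M. y / real M * f (p m)) = R M + y / real M * (f 0 - f y)"
    proof -
      have "(\<Sum>m<M. y / real M * f (p (Suc m)) - y / real M * f (p m)) = y / real M * f y - y / real M * f 0"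
        by (subst sum_lessThan_telescope) (simp add: pM)
      then have "R M - (\<Sum>m<M. y / real M * f (p m)) = y / real M * f y - y / real M * f 0"
        by (simp add: R_def p_def sum_subtractf)
      then show ?thesis
        by (simp add: algebra_simps)
    qed
    ultimately show ?thesis
      by simp
  qed
  have "R \<longlonglongrightarrow> G y"
  proof (rule tendsto_sandwich)
    show "\<forall>\<^sub>F M in sequentially. G y - y / real M * (f 0 - f y) \<le> R M"
      using bounds by (intro eventually_sequentiallyI[of 1]) (auto simp: algebra_simps)
    show "\<forall>\<^sub>F M in sequentially. R M \<le> G y"
      using bounds by (intro eventually_sequentiallyI[of 1]) auto
    have "(\<lambda>M. G y - y / real M * (f 0 - f y)) \<longlonglongrightarrow> G y - 0 * (f 0 - f y)"
      by (intro tendsto_intros lim_const_over_n)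
    then show "(\<lambda>M. G y - y / real M * (f 0 - f y)) \<longlonglongrightarrow> G y"
      by simp
  qed auto
  then show ?thesis
    by (simp add: R_def[abs_def] G_def)
qed

section \<open>The function arctan u / u and its integral\<close>

definition arctan_quot :: "real \<Rightarrow> real" where
  "arctan_quot u = (if u = 0 then 1 else arctan u / u)"

lemma continuous_on_arctan_quot: "continuous_on A arctan_quot"
proof -
  have "isCont arctan_quot u" for u
  proof (cases "u = 0")
    case True
    \<comment> \<open>This is the difference quotient of arctan at 0, which explains the value 1
      chosen there.\<close>
    have "((\<lambda>u. arctan u / u) \<longlongrightarrow> 1) (at 0)"
      using DERIV_arctan[of 0] by (simp add: DERIV_def)
    then have "(arctan_quot \<longlongrightarrow> 1) (at 0)"
      by (rule Lim_transform_eventually) (auto simp: arctan_quot_def eventually_at_filter)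
    then show ?thesis
      using True by (simp add: isCont_def arctan_quot_def)
  next
    case False
    have "isCont (\<lambda>u. arctan u / u) u"
      using False by (intro continuous_intros)
    moreover have "\<forall>\<^sub>F v in nhds u. arctan_quot v = arctan v / v"
      using t1_space_nhds[OF False] by eventually_elim (auto simp: arctan_quot_def)
    ultimately show ?thesis
      by (simp cong: isCont_cong)
  qed
  then show ?thesis
    by (simp add: continuous_at_imp_continuous_on)
qed

text \<open>By the mean value theorem, since the derivative of arctan decreases on the positive
  axis. The inequality says that arctan u / u has nonpositive derivative.\<close>

lemma arctan_ge:
  assumes "u > (0::real)"
  shows "u / (1 + u\<^sup>2) \<le> arctan u"
proof -
  obtain z where z: "0 < z" "z < u" "arctan u - arctan 0 = (u - 0) * inverse (1 + z\<^sup>2)"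
    using MVT2[OF assms, of arctan "\<lambda>z. inverse (1 + z\<^sup>2)"] DERIV_arctan by auto
  have "inverse (1 + u\<^sup>2) \<le> inverse (1 + z\<^sup>2)"
    using z by (intro le_imp_inverse_le add_left_mono power_mono) (auto intro: add_pos_nonneg)
  then show ?thesis
    using z assms by (simp add: divide_inverse mult_left_mono)
qed

lemma arctan_quot_antimono:
  assumes "0 \<le> s" "s \<le> t"
  shows "arctan_quot t \<le> arctan_quot s"
proof (cases "s = 0")
  case True
  then show ?thesis
    using arctan_le_self[of t] assms by (auto simp: arctan_quot_def)
next
  case False
  have "arctan t / t \<le> arctan s / s"
  proof (rule DERIV_nonpos_imp_nonincreasing[OF \<open>s \<le> t\<close>])
    fix x assume "s \<le> x" "x \<le> t"
    then have "x > 0"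
      using False assms by simp
    have "((\<lambda>x. arctan x / x) has_real_derivative ((inverse (1 + x\<^sup>2) * x - arctan x) / (x * x))) (at x)"
      using \<open>x > 0\<close> by (auto intro!: derivative_eq_intros)
    moreover have "(inverse (1 + x\<^sup>2) * x - arctan x) / (x * x) \<le> 0"
      using arctan_ge[OF \<open>x > 0\<close>] \<open>x > 0\<close> by (intro divide_nonpos_nonneg) (auto simp: divide_inverse mult.commute)
    ultimately show "\<exists>y. ((\<lambda>x. arctan x / x) has_real_derivative y) (at x) \<and> y \<le> 0"
      by blast
  qed
  then show ?thesis
    using False assms by (simp add: arctan_quot_def)
qed

text \<open>Both sides vanish at 1 and have the same derivative, because arctan y + arctan(1/y) =
  \<pi>/2. This is where the logarithm in the inversion formula originates.\<close>

lemma integral_arctan_quot_diff: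
  assumes "y > 0"
  shows "integral {0..y} arctan_quot - integral {0..1 / y} arctan_quot = pi / 2 * ln y"
proof -
  define G where "G x = integral {0..x} arctan_quot" for x
  have G: "(G has_real_derivative arctan x / x) (at x)" if "x > 0" for x
  proof -
    \<comment> \<open>The right end \<open>x + 1\<close> puts \<open>x\<close> in the interior, so
      that the derivative within the interval is a full derivative.\<close>
    have "(G has_real_derivative arctan_quot x) (at x within {0..x + 1})"
      unfolding G_def using that
      by (intro integral_has_real_derivative continuous_on_arctan_quot) auto
    then show ?thesis
      using that by (simp add: at_within_Icc_at arctan_quot_def)
  qed
  define D where "D x = G x - G (1 / x) - pi / 2 * ln x" for x
  have D: "(D has_real_derivative 0) (at x)" if "x > 0" for x
  proof -
    have "((\<lambda>x. 1 / x) has_real_derivative - (1 / x\<^sup>2)) (at x)"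
      using that by (auto intro!: derivative_eq_intros simp: power2_eq_square)
    then have "((\<lambda>x. G (1 / x)) has_real_derivative (arctan (1 / x) / (1 / x)) * - (1 / x\<^sup>2)) (at x)"
      using that by (intro DERIV_chain2[OF G]) auto
    then have "(D has_real_derivative arctan x / x - (arctan (1 / x) / (1 / x)) * - (1 / x\<^sup>2) - pi / 2 * (1 / x)) (at x)"
      unfolding D_def using that
      by (intro DERIV_diff G DERIV_cmult) (auto intro!: derivative_eq_intros)
    moreover have "arctan (1 / x) = pi / 2 - arctan x"
      using arctan_inverse[of x] that by (simp add: inverse_eq_divide)
    ultimately show ?thesis
      using that by (simp add: field_simps power2_eq_square)
  qed
  have "\<exists>c. \<forall>x\<in>{0<..}. D x = c"
    by (rule has_field_derivative_zero_constant)
       (use D in \<open>auto intro: has_field_derivative_at_within\<close>)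
  then have "D y = D 1"
    using assms by auto
  then show ?thesis
    by (simp add: D_def G_def)
qed

section \<open>Tails of the series of x / (n^2 + x^2)\<close>

text \<open>Mean value theorem for \<open>- arctan (x / t)\<close> as a function of
  \<open>t\<close>, whose derivative x / (t^2 + x^2) decreases.\<close>

lemma arctan_diff_bounds:
  fixes x t :: real
  assumes "x > 0" "t > 0"
  shows "x / ((t + 1)\<^sup>2 + x\<^sup>2) \<le> arctan (x / t) - arctan (x / (t + 1))"
    and "arctan (x / t) - arctan (x / (t + 1)) \<le> x / (t\<^sup>2 + x\<^sup>2)"
proof -
  have "((\<lambda>t. - arctan (x / t)) has_real_derivative x / (z\<^sup>2 + x\<^sup>2)) (at z)" if "z > 0" for z
  proof -
    have "((\<lambda>t. - arctan (x / t)) has_real_derivative - (inverse (1 + (x / z)\<^sup>2) * (- x / z\<^sup>2))) (at z)"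
      using that by (auto intro!: derivative_eq_intros simp: power2_eq_square)
    moreover have "1 + (x / z)\<^sup>2 = (z\<^sup>2 + x\<^sup>2) / z\<^sup>2"
      using that by (simp add: field_simps)
    ultimately show ?thesis
      using that by simp
  qed
  then obtain z where z: "t < z" "z < t + 1" "arctan (x / t) - arctan (x / (t + 1)) = x / (z\<^sup>2 + x\<^sup>2)"
    using MVT2[of t "t + 1" "\<lambda>t. - arctan (x / t)" "\<lambda>z. x / (z\<^sup>2 + x\<^sup>2)"] assms by auto
  have "t\<^sup>2 \<le> z\<^sup>2" "z\<^sup>2 \<le> (t + 1)\<^sup>2"
    using z assms by (auto intro!: power_mono)
  moreover have "0 < t\<^sup>2 + x\<^sup>2"
    using assms by (simp add: add_pos_pos)
  ultimately show "x / ((t + 1)\<^sup>2 + x\<^sup>2) \<le> arctan (x / t) - arctan (x / (t + 1))"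
    "arctan (x / t) - arctan (x / (t + 1)) \<le> x / (t\<^sup>2 + x\<^sup>2)"
    using assms unfolding z(3) by (auto intro!: divide_left_mono)
qed

text \<open>Each term is compared with a difference of arctangents and the differences telescope.
  The lower bound uses the interval of length 1 to the right of the summation index, the upper bound
  the one to its left, which explains the shift from \<open>N\<close> to
  \<open>Suc N\<close>.\<close>

lemma arctan_tail_bounds:
  fixes x :: real and N :: nat
  assumes "x > 0" "N > 0" and summ: "summable (\<lambda>n. x / (real (Suc n) ^ 2 + x ^ 2))"
  shows "arctan (x / real (Suc N)) \<le> (\<Sum>n. x / (real (Suc (n + N)) ^ 2 + x ^ 2))"
    and "(\<Sum>n. x / (real (Suc (n + N)) ^ 2 + x ^ 2)) \<le> arctan (x / real N)"
proof -
  have summ': "summable (\<lambda>n. x / (real (Suc (n + N)) ^ 2 + x ^ 2))"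
    using summable_ignore_initial_segment[OF summ, of N] .
  have tel: "(\<lambda>n. arctan (x / real (n + K)) - arctan (x / real (Suc n + K))) sums arctan (x / real K)" for K
  proof -
    have "(\<lambda>n. x / real (n + K)) \<longlonglongrightarrow> 0"
      using LIMSEQ_ignore_initial_segment[OF lim_const_over_n[of x], of K] .
    then have "(\<lambda>n. arctan (x / real (n + K))) \<longlonglongrightarrow> arctan 0"
      by (rule tendsto_arctan)
    from telescope_sums'[OF this] show ?thesis
      by simp
  qed
  note t1 = tel[of "Suc N"] and t2 = tel[of N]
  show "arctan (x / real (Suc N)) \<le> (\<Sum>n. x / (real (Suc (n + N)) ^ 2 + x ^ 2))"
  proof (rule sums_le[OF _ t1 summable_sums[OF summ']])
    fix n
    show "arctan (x / real (n + Suc N)) - arctan (x / real (Suc n + Suc N)) \<le> x / (real (Suc (n + N)) ^ 2 + x ^ 2)"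
      using arctan_diff_bounds(2)[of x "real (Suc (n + N))"] assms by (simp add: add_ac)
  qed
  show "(\<Sum>n. x / (real (Suc (n + N)) ^ 2 + x ^ 2)) \<le> arctan (x / real N)"
  proof (rule sums_le[OF _ summable_sums[OF summ'] t2])
    fix n
    show "x / (real (Suc (n + N)) ^ 2 + x ^ 2) \<le> arctan (x / real (n + N)) - arctan (x / real (Suc n + N))"
      using arctan_diff_bounds(1)[of x "real (n + N)"] assms by (simp add: add_ac)
  qed
qed

text \<open>Cutting the rows at the same \<open>M\<close> as the number of rows makes the inner tail
  about arctan(my/M). Divided by m, these values are the terms of a Riemann sum of
  \<open>arctan_quot\<close> on the interval from 0 to y.\<close>

lemma arctan_tail_sum_limit:
  fixes y :: real
  assumes "y > 0"
  shows "(\<lambda>M. \<Sum>m<M. 1 / real (Suc m) *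
            (\<Sum>n. (real (Suc m) * y) / (real (Suc (n + M)) ^ 2 + (real (Suc m) * y) ^ 2)))
         \<longlonglongrightarrow> integral {0..y} arctan_quot"
    (is "?S \<longlonglongrightarrow> ?I")
proof -
  define R where "R M = (\<Sum>m<M. y / real M * arctan_quot (y * real (Suc m) / real M))" for M
  have R: "R \<longlonglongrightarrow> ?I"
    unfolding R_def
    using assms by (intro Riemann_sum_antimono continuous_on_arctan_quot arctan_quot_antimono) auto
  have R_eq: "R M = (\<Sum>m<M. 1 / real (Suc m) * arctan (real (Suc m) * y / real M))" if "M > 0" for M
    unfolding R_def using that assms
    by (intro sum.cong refl) (simp add: arctan_quot_def field_simps del: of_nat_Suc)
  have tail: "arctan (real (Suc m) * y / real (Suc M)) \<le>
        (\<Sum>n. (real (Suc m) * y) / (real (Suc (n + M)) ^ 2 + (real (Suc m) * y) ^ 2))"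
      "(\<Sum>n. (real (Suc m) * y) / (real (Suc (n + M)) ^ 2 + (real (Suc m) * y) ^ 2)) \<le>
        arctan (real (Suc m) * y / real M)" if "M > 0" for m M
    using arctan_tail_bounds[of "real (Suc m) * y" M] that assms
      sums_summable[OF coth_partial_fractions[of "real (Suc m) * y"]] by auto
  show ?thesis
  proof (rule tendsto_sandwich)
    show "\<forall>\<^sub>F M in sequentially. R (Suc M) - arctan y / real (Suc M) \<le> ?S M"
    proof (intro eventually_sequentiallyI[of 1])
      fix M :: nat assume "1 \<le> M"
      \<comment> \<open>The Riemann sum with \<open>Suc M\<close> points has one summand too many.
        It belongs to the right endpoint y and equals the subtracted quotient.\<close>
      have "R (Suc M) - arctan y / real (Suc M) = (\<Sum>m<M. 1 / real (Suc m) * arctan (real (Suc m) * y / real (Suc M)))"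
        by (simp add: R_eq del: of_nat_Suc)
      also have "\<dots> \<le> ?S M"
        using tail(1)[of M] \<open>1 \<le> M\<close> by (intro sum_mono mult_left_mono) auto
      finally show "R (Suc M) - arctan y / real (Suc M) \<le> ?S M" .
    qed
    show "\<forall>\<^sub>F M in sequentially. ?S M \<le> R M"
    proof (intro eventually_sequentiallyI[of 1])
      fix M :: nat assume "1 \<le> M"
      have "?S M \<le> (\<Sum>m<M. 1 / real (Suc m) * arctan (real (Suc m) * y / real M))"
        using tail(2)[of M] \<open>1 \<le> M\<close> by (intro sum_mono mult_left_mono) auto
      then show "?S M \<le> R M"
        using \<open>1 \<le> M\<close> by (simp add: R_eq)
    qed
    have "(\<lambda>M. R (Suc M) - arctan y / real (Suc M)) \<longlonglongrightarrow> ?I - 0"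
      by (intro tendsto_diff LIMSEQ_Suc[OF R] LIMSEQ_Suc[OF lim_const_over_n])
    then show "(\<lambda>M. R (Suc M) - arctan y / real (Suc M)) \<longlonglongrightarrow> ?I"
      by simp
  qed (rule R)
qed

section \<open>The Lambert series\<close>

text \<open>For positive y the sum over all indices is the negative logarithm of the Euler product
  at exp(-2\<pi>y). The index is shifted so that it starts at 1.\<close>

definition lambert_term :: "real \<Rightarrow> nat \<Rightarrow> real" where
  "lambert_term y m = 1 / (real (Suc m) * (exp (2 * pi * (real (Suc m) * y)) - 1))"

text \<open>The expansion of coth at \<open>Suc m * y\<close>, solved for the term with the
  exponential and divided by \<open>Suc m\<close>.\<close>

lemma lambert_partial_fractions:
  assumes "y > 0"
  shows "lambert_term y m = 1 / pi * (1 / real (Suc m) *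
      (\<Sum>n. (real (Suc m) * y) / (real (Suc n) ^ 2 + (real (Suc m) * y) ^ 2)))
      - 1 / (2 * real (Suc m)) + 1 / (2 * pi * y) * (1 / real (Suc m) ^ 2)"
proof -
  define x where "x = real (Suc m) * y"
  have "x > 0"
    using assms by (simp add: x_def)
  have "exp (2 * pi * x) > 1"
    using \<open>x > 0\<close> by simp
  have "(\<Sum>n. x / (real (Suc n) ^ 2 + x ^ 2)) = pi / 2 + pi / (exp (2 * pi * x) - 1) - 1 / (2 * x)"
    using coth_partial_fractions[OF \<open>x > 0\<close>] by (simp add: sums_iff)
  moreover have "1 / (s * (E - 1)) = 1 / pi * (1 / s * (pi / 2 + pi / (E - 1) - 1 / (2 * (s * y))))
      - 1 / (2 * s) + 1 / (2 * pi * y) * (1 / s ^ 2)" if "s > 0" "E > 1" for s E :: real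
    using that assms by (simp add: field_simps power2_eq_square)
  ultimately show ?thesis
    using \<open>exp (2 * pi * x) > 1\<close> unfolding lambert_term_def x_def by simp
qed

text \<open>Of the pieces of the partial sums, the harmonic sums are independent of y and cancel,
  the squares cancel by symmetry, the tails tend to integrals whose difference is \<pi>/2 ln y, and
  the sum of 1/m^2 tends to \<pi>^2/6, which gives the term with 1/y - y.\<close>

lemma lambert_inversion:
  fixes y :: real
  assumes "y > 0"
  shows "(\<lambda>M. \<Sum>m<M. lambert_term y m - lambert_term (1 / y) m) \<longlonglongrightarrow> pi / 12 * (1 / y - y) + ln y / 2"
proof -
  define x where "x y m = real (Suc m) * y" for y m
  define c where "c y m n = 1 / real (Suc m) * (x y m / (real (Suc n) ^ 2 + x y m ^ 2))" for y m n
  have x: "x y m > 0" if "y > 0" for y m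
    using that by (simp add: x_def)
  have summ: "summable (\<lambda>n. x y m / (real (Suc n) ^ 2 + x y m ^ 2))" if "y > 0" for y m
    using sums_summable[OF coth_partial_fractions[OF x[OF that]]] .
  \<comment> \<open>The part of the first \<open>M\<close> rows outside the square of side
    \<open>M\<close>.\<close>
  define H where "H M y = (\<Sum>m<M. 1 / real (Suc m) * (\<Sum>n. x y m / (real (Suc (n + M)) ^ 2 + x y m ^ 2)))" for M y
  have H: "(\<lambda>M. H M y) \<longlonglongrightarrow> integral {0..y} arctan_quot" if "y > 0" for y
    unfolding H_def x_def by (rule arctan_tail_sum_limit[OF that])
  have part: "(\<Sum>m<M. lambert_term y m) = 1 / pi * ((\<Sum>m<M. \<Sum>n<M. c y m n) + H M y)
      - (\<Sum>m<M. 1 / (2 * real (Suc m))) + 1 / (2 * pi * y) * (\<Sum>m<M. 1 / real (Suc m) ^ 2)" if "y > 0" for y M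
  proof -
    have "lambert_term y m = 1 / pi * ((\<Sum>n<M. c y m n) + 1 / real (Suc m) * (\<Sum>n. x y m / (real (Suc (n + M)) ^ 2 + x y m ^ 2)))
      - 1 / (2 * real (Suc m)) + 1 / (2 * pi * y) * (1 / real (Suc m) ^ 2)" for m
    proof -
      have "(\<Sum>n. x y m / (real (Suc n) ^ 2 + x y m ^ 2)) =
          (\<Sum>n. x y m / (real (Suc (n + M)) ^ 2 + x y m ^ 2)) + (\<Sum>n<M. x y m / (real (Suc n) ^ 2 + x y m ^ 2))"
        by (rule suminf_split_initial_segment[OF summ[OF that]])
      then have "1 / real (Suc m) * (\<Sum>n. x y m / (real (Suc n) ^ 2 + x y m ^ 2)) =
          (\<Sum>n<M. c y m n) + 1 / real (Suc m) * (\<Sum>n. x y m / (real (Suc (n + M)) ^ 2 + x y m ^ 2))"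
        unfolding c_def by (simp only: sum_distrib_left distrib_left add.commute)
      then show ?thesis
        unfolding lambert_partial_fractions[OF that] x_def[symmetric] by (simp only:)
    qed
    then show ?thesis
      by (simp only: sum.distrib sum_subtractf sum_distrib_left[symmetric] H_def)
  qed
  \<comment> \<open>After cancellation \<open>c y m n\<close> is y / (n^2 + m^2 y^2) with both
    indices shifted by 1, and multiplying numerator and denominator by y^2 exchanges their
    roles.\<close>
  have c_swap: "c (1 / y) m n = c y n m" for m n
  proof -
    have "c y m n = y / (real (Suc n) ^ 2 + (real (Suc m) * y) ^ 2)" for y m n
      by (simp add: c_def x_def del: of_nat_Suc)
    moreover have "(1 / y) / (a ^ 2 + (b * (1 / y)) ^ 2) = y / (b ^ 2 + (a * y) ^ 2)" if "a > 0" "b > 0" for a b :: real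
    proof -
      have "a ^ 2 + (b * (1 / y)) ^ 2 = (b ^ 2 + (a * y) ^ 2) / y ^ 2"
        using assms by (simp add: field_simps)
      then show ?thesis
        using assms by (simp add: power2_eq_square)
    qed
    ultimately show ?thesis
      by (simp del: of_nat_Suc)
  qed
  have sym: "(\<Sum>m<M. \<Sum>n<M. c (1 / y) m n) = (\<Sum>m<M. \<Sum>n<M. c y m n)" for M
    unfolding c_swap by (rule sum.swap)
  \<comment> \<open>The harmonic sums diverge, so they are cancelled at finite \<open>M\<close>,
    before the limit is taken.\<close>
  have eq: "(\<Sum>m<M. lambert_term y m - lambert_term (1 / y) m) =
      1 / pi * (H M y - H M (1 / y)) + 1 / (2 * pi) * (1 / y - y) * (\<Sum>m<M. 1 / real (Suc m) ^ 2)" for M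
    using assms part[of y M] part[of "1 / y" M] sym[of M]
    by (simp add: sum_subtractf algebra_simps diff_divide_distrib add_divide_distrib)
  have "(\<lambda>M. 1 / pi * (H M y - H M (1 / y)) + 1 / (2 * pi) * (1 / y - y) * (\<Sum>m<M. 1 / real (Suc m) ^ 2))
      \<longlonglongrightarrow> 1 / pi * (integral {0..y} arctan_quot - integral {0..1 / y} arctan_quot) + 1 / (2 * pi) * (1 / y - y) * (pi ^ 2 / 6)"
    using inverse_squares_sums assms
    by (intro tendsto_intros H) (auto simp: sums_def add.commute)
  also have "1 / pi * (integral {0..y} arctan_quot - integral {0..1 / y} arctan_quot) + 1 / (2 * pi) * (1 / y - y) * (pi ^ 2 / 6)
      = pi / 12 * (1 / y - y) + ln y / 2"
    unfolding integral_arctan_quot_diff[OF assms] by (simp add: power2_eq_square)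
  finally show ?thesis
    unfolding eq .
qed

section \<open>The Euler product\<close>

definition euler_prod :: "complex \<Rightarrow> complex" where
  "euler_prod q = (\<Prod>n. 1 - q ^ Suc n)"

lemma convergent_euler_prod:
  fixes q :: complex
  assumes "norm q < 1"
  shows "convergent_prod (\<lambda>n. 1 - q ^ Suc n)"
proof -
  have "summable (\<lambda>n. norm q ^ n)"
    using assms by (intro summable_geometric) simp
  then have "summable (\<lambda>n. norm q ^ Suc n)"
    by (subst summable_Suc_iff)
  then show ?thesis
    by (intro abs_convergent_prod_imp_convergent_prod summable_imp_abs_convergent_prod)
       (simp add: norm_power norm_mult)
qed

lemma power_Suc_neq_1:
  fixes q :: complex
  assumes "norm q < 1"
  shows "q ^ Suc n \<noteq> 1"
proof -
  have "norm q ^ Suc n \<le> norm q ^ 1"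
    using assms by (intro power_decreasing) auto
  then have "norm (q ^ Suc n) < 1"
    using assms by (simp only: norm_power power_one_right)
  then show ?thesis
    by auto
qed

lemma euler_prod_nonzero:
  assumes "norm q < 1"
  shows "euler_prod q \<noteq> 0"
  unfolding euler_prod_def
  using power_Suc_neq_1[OF assms] by (intro prodinf_nonzero convergent_euler_prod assms) (auto simp del: power_Suc)

lemma euler_prod_LIMSEQ:
  assumes "norm q < 1"
  shows "(\<lambda>N. \<Prod>n<N. 1 - q ^ Suc n) \<longlonglongrightarrow> euler_prod q"
  using convergent_prod_LIMSEQ[OF convergent_euler_prod[OF assms]]
  by (simp add: LIMSEQ_lessThan_iff_atMost euler_prod_def del: power_Suc)

text \<open>The partial products are polynomials that converge uniformly on each closed disk inside
  the unit disk: by compactness such a disk has norm at most some r < 1, and the powers of r serve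
  in the Weierstrass test.\<close>

lemma holomorphic_euler_prod: "euler_prod holomorphic_on ball 0 1"
proof (rule holomorphic_uniform_sequence)
  show "(\<lambda>q. \<Prod>n<N. 1 - q ^ Suc n) holomorphic_on ball 0 1" for N
    by (intro holomorphic_intros)
next
  fix z :: complex assume z: "z \<in> ball 0 1"
  then obtain d where d: "0 < d" "cball z d \<subseteq> ball 0 1"
    using open_contains_cball by blast
  have "\<exists>r<1. \<forall>q\<in>cball z d. norm q \<le> r"
  proof -
    have "\<exists>w\<in>cball z d. \<forall>q\<in>cball z d. norm q \<le> norm w"
      using d by (intro continuous_attains_sup continuous_intros) auto
    then obtain w where w: "w \<in> cball z d" "\<forall>q\<in>cball z d. norm q \<le> norm w"
      by blast
    then have "norm w < 1"
      using d by auto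
    then show ?thesis
      using w by blast
  qed
  then obtain r where r: "r < 1" "\<And>q. q \<in> cball z d \<Longrightarrow> norm q \<le> r"
    by blast
  have "r \<ge> 0"
    using r(2)[of z] d by (intro order_trans[OF norm_ge_zero[of z]]) auto
  have "uniformly_convergent_on (cball z d) (\<lambda>N q. \<Prod>n<N. 1 - q ^ Suc n)"
  proof (rule Complex_Transcendental.uniformly_convergent_on_prod')
    have "summable (\<lambda>n. r ^ Suc n)"
      using \<open>r \<ge> 0\<close> \<open>r < 1\<close> by (subst summable_Suc_iff) (simp add: summable_geometric)
    then show "uniformly_convergent_on (cball z d) (\<lambda>N q. \<Sum>n<N. norm (1 - q ^ Suc n - 1))"
      using r by (intro Weierstrass_m_test'[where M = "\<lambda>n. r ^ Suc n"])
        (auto simp: norm_power simp del: power_Suc intro!: power_mono)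
  qed (auto intro!: continuous_intros)
  then have ul: "uniform_limit (cball z d) (\<lambda>N q. \<Prod>n<N. 1 - q ^ Suc n)
      (\<lambda>q. lim (\<lambda>N. \<Prod>n<N. 1 - q ^ Suc n)) sequentially"
    by (simp only: uniformly_convergent_uniform_limit_iff)
  have lim: "lim (\<lambda>N. \<Prod>n<N. 1 - q ^ Suc n) = euler_prod q" if "q \<in> cball z d" for q
    using that d by (intro limI euler_prod_LIMSEQ) auto
  have "uniform_limit (cball z d) (\<lambda>N q. \<Prod>n<N. 1 - q ^ Suc n) euler_prod sequentially"
    by (rule iffD1[OF uniform_limit_cong'[OF refl lim] ul])
  then show "\<exists>d>0. cball z d \<subseteq> ball 0 1 \<and>
      uniform_limit (cball z d) (\<lambda>N q. \<Prod>n<N. 1 - q ^ Suc n) euler_prod sequentially"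
    using d by blast
qed simp

section \<open>The logarithm of the Euler product at real points\<close>

lemma ln_one_minus_sums:
  fixes u :: real
  assumes "0 \<le> u" "u < 1"
  shows "(\<lambda>j. u ^ Suc j / real (Suc j)) sums - ln (1 - u)"
proof -
  have "(\<lambda>n. u ^ n / real n) sums - ln (1 - u)"
    using sums_minus[OF ln_series'[of "- u"]] assms by simp
  \<comment> \<open>The term at \<open>n = 0\<close> is 0, as division by 0 yields 0, so shifting
    the index does not change the sum.\<close>
  then show ?thesis
    by (subst sums_Suc_iff) simp
qed

lemma lambert_term_altdef:
  assumes "y > 0" "q = exp (- 2 * pi * y)"
  shows "lambert_term y j = q ^ Suc j / (1 - q ^ Suc j) / real (Suc j)"
proof -
  have "q ^ Suc j = 1 / exp (2 * pi * (real (Suc j) * y))"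
  proof -
    have "q ^ Suc j = exp (- (2 * pi * (real (Suc j) * y)))"
      unfolding assms(2) exp_of_nat_mult[symmetric] by (rule arg_cong[of _ _ exp]) simp
    then show ?thesis
      by (simp add: exp_minus divide_inverse del: power_Suc of_nat_Suc)
  qed
  moreover have "exp (2 * pi * (real (Suc j) * y)) > 1"
    using assms(1) by simp
  moreover have "1 / (s * (E - 1)) = 1 / E / (1 - 1 / E) / s" if "s > 0" "E > 1" for s E :: real
    using that by (simp add: field_simps)
  ultimately show ?thesis
    unfolding lambert_term_def by (simp del: of_nat_Suc power_Suc)
qed

text \<open>Both series are iterated sums of the nonnegative double series of q^(jn) / j over j, n
  \<ge> 1. Summing over n first gives geometric series and hence the Lambert terms; summing over j
  first gives logarithms. Nonnegativity permits the exchange.\<close>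

lemma ln_euler_prod_sums:
  assumes "y > 0" "q = exp (- 2 * pi * y)"
  shows "summable (lambert_term y)"
    and "(\<lambda>n. - ln (1 - q ^ Suc n)) sums (\<Sum>j. lambert_term y j)"
proof -
  have q: "0 < q" "q < 1"
    using assms by simp_all
  have qS: "0 < q ^ Suc n" "q ^ Suc n < 1" for n
    using q power_Suc_less_one[of q n] by simp_all
  have nonneg: "lambert_term y j \<ge> 0" for j
    using qS[of j] unfolding lambert_term_altdef[OF assms] by simp
  show summ: "summable (lambert_term y)"
  proof (rule summable_comparison_test')
    show "summable (\<lambda>j. q ^ j * (1 / (1 - q)))"
      using q by (intro summable_mult2 summable_geometric) simp
    fix j :: nat
    have "q ^ Suc j / (1 - q ^ Suc j) / real (Suc j) \<le> q ^ Suc j / (1 - q ^ Suc j) / 1"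
      using qS[of j] by (intro divide_left_mono) auto
    also have "\<dots> \<le> q ^ j / (1 - q)"
      using q power_Suc_le_self[of q j] power_decreasing[of j "Suc j" q] power_decreasing[of 1 "Suc j" q]
      by (simp del: power_Suc) (intro frac_le; simp)
    finally show "norm (lambert_term y j) \<le> q ^ j * (1 / (1 - q))"
      unfolding real_norm_def abs_of_nonneg[OF nonneg] unfolding lambert_term_altdef[OF assms] by simp
  qed
  define f where "f = (\<lambda>(j, n). q ^ (Suc j * Suc n) / real (Suc j))"
  have f_nonneg: "f p \<ge> 0" for p
    using q by (simp add: f_def split: prod.split)
  have row: "((\<lambda>n. f (j, n)) has_sum lambert_term y j) UNIV" for j
  proof (rule sums_nonneg_imp_has_sum)
    have "(\<lambda>n. (q ^ Suc j) ^ n) sums (1 / (1 - q ^ Suc j))"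
      using qS[of j] by (intro geometric_sums) simp
    then have "(\<lambda>n. q ^ Suc j / real (Suc j) * (q ^ Suc j) ^ n) sums (q ^ Suc j / real (Suc j) * (1 / (1 - q ^ Suc j)))"
      by (rule sums_mult)
    moreover have "f (j, n) = q ^ Suc j / real (Suc j) * (q ^ Suc j) ^ n" for n
      unfolding f_def prod.case power_mult power_Suc[of "q ^ Suc j"] by (simp del: power_Suc of_nat_Suc)
    ultimately show "(\<lambda>n. f (j, n)) sums lambert_term y j"
      unfolding lambert_term_altdef[OF assms] by (simp add: mult.commute del: power_Suc of_nat_Suc)
  qed (rule f_nonneg)
  have col: "((\<lambda>j. f (j, n)) has_sum - ln (1 - q ^ Suc n)) UNIV" for n
  proof (rule sums_nonneg_imp_has_sum)
    have "f (j, n) = (q ^ Suc n) ^ Suc j / real (Suc j)" for j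
      unfolding f_def power_mult[symmetric] by (simp add: mult.commute)
    then show "(\<lambda>j. f (j, n)) sums - ln (1 - q ^ Suc n)"
      using ln_one_minus_sums[of "q ^ Suc n"] qS[of n] by (simp del: power_Suc of_nat_Suc)
  qed (rule f_nonneg)
  have total: "(lambert_term y has_sum (\<Sum>j. lambert_term y j)) UNIV"
    by (intro sums_nonneg_imp_has_sum summable_sums summ nonneg)
  have "f summable_on UNIV \<times> UNIV"
    by (rule summable_on_SigmaI[OF row]) (use total in \<open>auto simp: summable_on_def f_nonneg\<close>)
  then have "(f has_sum (\<Sum>j. lambert_term y j)) (UNIV \<times> UNIV)"
    by (intro has_sum_SigmaI[OF row total])
  then have "((\<lambda>(n, j). f (j, n)) has_sum (\<Sum>j. lambert_term y j)) (UNIV \<times> UNIV)"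
    by (subst (asm) has_sum_swap)
  then have "((\<lambda>n. - ln (1 - q ^ Suc n)) has_sum (\<Sum>j. lambert_term y j)) UNIV"
    by (rule has_sum_SigmaD) (use col in auto)
  then show "(\<lambda>n. - ln (1 - q ^ Suc n)) sums (\<Sum>j. lambert_term y j)"
    by (rule has_sum_imp_sums)
qed

lemma euler_prod_of_real:
  assumes "y > 0" "q = exp (- 2 * pi * y)"
  shows "euler_prod (of_real q) = of_real (exp (- (\<Sum>j. lambert_term y j)))"
proof -
  have q: "0 < q" "q < 1"
    using assms by simp_all
  have "(\<Prod>n<N. 1 - complex_of_real q ^ Suc n) = of_real (exp (- (\<Sum>n<N. - ln (1 - q ^ Suc n))))" for N
  proof -
    have "exp (- (\<Sum>n<N. - ln (1 - q ^ Suc n))) = (\<Prod>n<N. exp (ln (1 - q ^ Suc n)))"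
      by (simp add: exp_sum sum_negf)
    also have "\<dots> = (\<Prod>n<N. 1 - q ^ Suc n)"
      using q power_Suc_less_one[of q] by (intro prod.cong) (auto simp del: power_Suc)
    finally show ?thesis
      by simp
  qed
  moreover have "(\<lambda>N. complex_of_real (exp (- (\<Sum>n<N. - ln (1 - q ^ Suc n))))) \<longlonglongrightarrow>
      of_real (exp (- (\<Sum>j. lambert_term y j)))"
    using ln_euler_prod_sums(2)[OF assms] unfolding sums_def by (intro tendsto_intros)
  ultimately show ?thesis
    using euler_prod_LIMSEQ[of "of_real q"] q LIMSEQ_unique by (simp del: power_Suc)
qed

section \<open>The inversion law of the eta function\<close>

lemma norm_nome_less_1:
  assumes "\<tau> \<in> upper_half_plane"
  shows "norm (nome \<tau>) < 1"
  using assms by (simp add: nome_def upper_half_plane_def)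

lemma dedekind_eta_euler_prod: "dedekind_eta \<tau> = exp (2 * of_real pi * \<i> * \<tau> / 24) * euler_prod (nome \<tau>)"
  by (simp add: dedekind_eta_def euler_prod_def)

lemma dedekind_eta_nonzero: "\<tau> \<in> upper_half_plane \<Longrightarrow> dedekind_eta \<tau> \<noteq> 0"
  by (simp add: dedekind_eta_euler_prod euler_prod_nonzero norm_nome_less_1)

lemma holomorphic_nome: "nome holomorphic_on A"
  unfolding nome_def by (intro holomorphic_intros)

lemma holomorphic_dedekind_eta: "dedekind_eta holomorphic_on upper_half_plane"
proof -
  have "(euler_prod \<circ> nome) holomorphic_on upper_half_plane"
    by (rule holomorphic_on_compose_gen[OF holomorphic_nome holomorphic_euler_prod])
       (auto simp: norm_nome_less_1)
  then show ?thesis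
    unfolding dedekind_eta_euler_prod[abs_def] comp_def by (intro holomorphic_intros) auto
qed

lemma dedekind_eta_imaginary_axis:
  assumes "y > 0"
  shows "dedekind_eta (\<i> * of_real y) = of_real (exp (- pi * y / 12 - (\<Sum>j. lambert_term y j)))"
proof -
  have "nome (\<i> * of_real y) = of_real (exp (- 2 * pi * y))"
    unfolding nome_def exp_of_real[symmetric] by (rule arg_cong[of _ _ exp]) (simp add: algebra_simps)
  moreover have "exp (2 * of_real pi * \<i> * (\<i> * of_real y) / 24) = complex_of_real (exp (- pi * y / 12))"
    unfolding exp_of_real[symmetric] by (rule arg_cong[of _ _ exp]) (simp add: algebra_simps)
  ultimately show ?thesis
    by (simp only: dedekind_eta_euler_prod euler_prod_of_real[OF assms refl] of_real_mult[symmetric]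
        exp_add[symmetric] diff_conv_add_uminus)
qed

text \<open>The term with 1/y - y in the inversion of the Lambert series accounts for the prefactors
  exp(2\<pi>i\<tau>/24) at the two points, and ln y / 2 becomes the factor y after squaring.\<close>

lemma dedekind_eta_imaginary_axis_inversion:
  assumes "y > 0"
  shows "dedekind_eta (\<i> * of_real (1 / y)) ^ 2 = of_real y * dedekind_eta (\<i> * of_real y) ^ 2"
proof -
  define \<Lambda> where "\<Lambda> y = (\<Sum>j. lambert_term y j)" for y
  have "(\<lambda>M. \<Sum>m<M. lambert_term y m - lambert_term (1 / y) m) \<longlonglongrightarrow> \<Lambda> y - \<Lambda> (1 / y)"
    using sums_diff[OF summable_sums summable_sums, OF ln_euler_prod_sums(1) ln_euler_prod_sums(1)] assms
    unfolding sums_def \<Lambda>_def by simp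
  then have "\<Lambda> y - \<Lambda> (1 / y) = pi / 12 * (1 / y - y) + ln y / 2"
    using lambert_inversion[OF assms] LIMSEQ_unique by blast
  then have "- pi * (1 / y) / 12 - \<Lambda> (1 / y) = - pi * y / 12 - \<Lambda> y + ln y / 2"
    by (simp add: algebra_simps diff_divide_distrib)
  moreover have "exp (- pi * y / 12 - \<Lambda> y + ln y / 2) ^ 2 = y * exp (- pi * y / 12 - \<Lambda> y) ^ 2"
  proof -
    have "exp (ln y / 2) ^ 2 = y"
      using assms by (simp flip: exp_double)
    then show ?thesis
      unfolding exp_add power_mult_distrib by simp
  qed
  ultimately have "exp (- pi * (1 / y) / 12 - \<Lambda> (1 / y)) ^ 2 = y * exp (- pi * y / 12 - \<Lambda> y) ^ 2"
    by simp
  moreover have "1 / y > 0"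
    using assms by simp
  ultimately show ?thesis
    unfolding dedekind_eta_imaginary_axis[OF assms] dedekind_eta_imaginary_axis[OF \<open>1 / y > 0\<close>] \<Lambda>_def
    by (simp flip: of_real_power of_real_mult)
qed

text \<open>Identity theorem: the difference \<open>h\<close> of the two sides is holomorphic on the
  half-plane and vanishes on the positive imaginary axis, which has the limit point
  \<open>\<i>\<close>.\<close>

lemma dedekind_eta_inversion:
  assumes "\<tau> \<in> upper_half_plane"
  shows "dedekind_eta (- 1 / \<tau>) ^ 2 = - \<i> * \<tau> * dedekind_eta \<tau> ^ 2"
proof -
  let ?H = upper_half_plane
  let ?U = "{\<tau>. \<exists>y>0. \<tau> = \<i> * of_real y}"
  define h where "h \<tau> = dedekind_eta (- 1 / \<tau>) ^ 2 + \<i> * \<tau> * dedekind_eta \<tau> ^ 2" for \<tau>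
  have img: "- 1 / \<tau> \<in> ?H" if "\<tau> \<in> ?H" for \<tau>
    using that by (auto simp: upper_half_plane_def Im_divide intro!: divide_pos_pos add_nonneg_pos)
  have "(dedekind_eta \<circ> (\<lambda>\<tau>. - 1 / \<tau>)) holomorphic_on ?H"
    by (rule holomorphic_on_compose_gen[OF _ holomorphic_dedekind_eta])
       (use img in \<open>auto intro!: holomorphic_intros simp: upper_half_plane_def\<close>)
  then have hol: "h holomorphic_on ?H"
    unfolding h_def comp_def by (intro holomorphic_intros holomorphic_dedekind_eta)
  have opn: "open ?H"
    unfolding upper_half_plane_def by (rule open_halfspace_Im_gt)
  have "convex ?H"
    unfolding upper_half_plane_def by (rule convex_halfspace_Im_gt)
  then have conn: "connected ?H"
    by (rule convex_connected)
  have lim: "\<i> islimpt ?U"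
    unfolding islimpt_approachable
  proof (intro allI impI)
    fix e :: real assume "e > 0"
    then show "\<exists>x'\<in>?U. x' \<noteq> \<i> \<and> dist x' \<i> < e"
      by (intro bexI[of _ "\<i> * of_real (1 + e / 2)"])
         (auto simp: dist_norm algebra_simps norm_mult complex_eq_iff intro!: exI[of _ "1 + e / 2"])
  qed
  have zero: "h z = 0" if "z \<in> ?U" for z
  proof -
    from that obtain y where y: "y > 0" "z = \<i> * of_real y"
      by blast
    then have "- 1 / z = \<i> * of_real (1 / y)"
      by (simp add: field_simps)
    moreover have "\<i> * z = - of_real y"
      using y by (simp add: mult.assoc[symmetric])
    ultimately show ?thesis
      unfolding h_def using dedekind_eta_imaginary_axis_inversion[OF y(1)] y by simp
  qed
  have "h \<tau> = 0"
    by (rule analytic_continuation[OF hol opn conn _ _ lim zero assms])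
       (auto simp: upper_half_plane_def)
  then show ?thesis
    by (simp add: h_def add_eq_0_iff)
qed

lemma dedekind_eta_translation:
  "dedekind_eta (\<tau> + 1) ^ 2 = exp (2 * of_real pi * \<i> / 12) * dedekind_eta \<tau> ^ 2"
proof -
  have "nome (\<tau> + 1) = nome \<tau>"
    by (simp add: nome_def distrib_left exp_add)
  moreover have "exp (2 * of_real pi * \<i> * (\<tau> + 1) / 24) ^ 2 =
      exp (2 * of_real pi * \<i> / 12) * exp (2 * of_real pi * \<i> * \<tau> / 24) ^ 2"
    by (simp add: exp_add[symmetric] exp_double[symmetric] algebra_simps add_divide_distrib)
  ultimately show ?thesis
    by (simp add: dedekind_eta_euler_prod power_mult_distrib)
qed

section \<open>Generators of the modular group\<close>

lemma matrix_mult_2: "(A ** B) $ i $ j = A $ i $ 1 * B $ 1 $ j + A $ i $ 2 * B $ 2 $ j"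
  for A B :: "'a::comm_semiring_1^2^2"
  by (simp add: matrix_matrix_mult_def sum_2)

lemma matrix_eq_2: "A = B \<longleftrightarrow> A$1$1 = B$1$1 \<and> A$1$2 = B$1$2 \<and> A$2$1 = B$2$1 \<and> A$2$2 = B$2$2"
  for A B :: "'a^2^2"
  by (simp only: vec_eq_iff forall_2 conj_assoc)

lemma mat_2:
  fixes z :: "'a::zero"
  shows "(mat z :: 'a^2^2) $ 1 $ 1 = z" "(mat z :: 'a^2^2) $ 1 $ 2 = 0"
    "(mat z :: 'a^2^2) $ 2 $ 1 = 0" "(mat z :: 'a^2^2) $ 2 $ 2 = z"
  by (simp_all add: mat_def)

lemmas matrix_2_simps = matrix_eq_2 matrix_mult_2 mat_2 vector_2

lemma SL2Z_simps [simp]: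
  "x \<otimes>\<^bsub>SL2Z\<^esub> y = x ** y" "\<one>\<^bsub>SL2Z\<^esub> = mat 1"
  by (simp_all add: SL2Z_def)

lemma carrier_SL2Z_iff: "\<gamma> \<in> carrier SL2Z \<longleftrightarrow> \<gamma>$1$1 * \<gamma>$2$2 - \<gamma>$1$2 * \<gamma>$2$1 = 1"
  by (simp add: SL2Z_def det_2)

lemma group_SL2Z: "group SL2Z"
proof (rule groupI)
  fix \<gamma> assume "\<gamma> \<in> carrier SL2Z"
  then show "\<exists>\<delta>\<in>carrier SL2Z. \<delta> \<otimes>\<^bsub>SL2Z\<^esub> \<gamma> = \<one>\<^bsub>SL2Z\<^esub>"
    by (intro bexI[of _ "vector [vector [\<gamma>$2$2, - \<gamma>$1$2], vector [- \<gamma>$2$1, \<gamma>$1$1]]"])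
       (auto simp: carrier_SL2Z_iff matrix_2_simps algebra_simps)
qed (auto simp: SL2Z_def det_mul matrix_mul_assoc)

interpretation SL2Z: group SL2Z
  by (rule group_SL2Z)

text \<open>This is T^n, given by its entries so that negative n is included.\<close>

definition translation :: "int \<Rightarrow> int^2^2" where
  "translation n = vector [vector [1, n], vector [0, 1]]"

lemma translation_mult: "translation m ** translation n = translation (m + n)"
  by (simp add: translation_def matrix_2_simps)

lemma translation_1: "translation 1 = T_mat"
  by (simp add: translation_def T_mat_def)

lemma translation_0: "translation 0 = mat 1"
  by (simp add: translation_def matrix_2_simps)

lemma translation_carrier [simp]: "translation n \<in> carrier SL2Z"
  by (simp add: translation_def carrier_SL2Z_iff)

lemma S_mat_carrier [simp]: "S_mat \<in> carrier SL2Z"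
  by (simp add: S_mat_def carrier_SL2Z_iff)

lemma T_mat_carrier [simp]: "T_mat \<in> carrier SL2Z"
  by (metis translation_1 translation_carrier)

lemma minus_one_carrier: "mat (- 1) \<in> carrier SL2Z"
  by (simp add: carrier_SL2Z_iff mat_2)

lemma translation_uminus: "translation (- n) = inv\<^bsub>SL2Z\<^esub> translation n"
  by (rule SL2Z.inv_equality[symmetric]) (simp_all add: translation_mult translation_0)

lemma translation_in_subgroup:
  assumes "subgroup K SL2Z" "T_mat \<in> K"
  shows "translation n \<in> K"
proof (induction n rule: int_induct[where k = 0])
  case base
  show ?case
    using subgroup.one_closed[OF assms(1)] by (simp add: translation_0)
next
  case (step1 n)
  then show ?case
    using subgroup.m_closed[OF assms(1) step1(2) assms(2)] by (simp add: translation_mult flip: translation_1)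
next
  case (step2 n)
  have "translation (- 1) \<in> K"
    using subgroup.m_inv_closed[OF assms] by (simp add: translation_uminus translation_1)
  then show ?case
    using subgroup.m_closed[OF assms(1) step2(2)] by (force simp: translation_mult)
qed

lemma S_mat_square: "S_mat ** S_mat = mat (- 1)"
  by (simp add: S_mat_def matrix_2_simps)

text \<open>Euclid's algorithm on the first column: \<open>S T^{-q}\<close> replaces the column \<open>(a, c)\<close>
  by \<open>(-c, a mod c)\<close> for \<open>q = a div c\<close>.\<close>

lemma SL2Z_generated:
  assumes K: "subgroup K SL2Z" "S_mat \<in> K" "T_mat \<in> K" and "\<gamma> \<in> carrier SL2Z"
  shows "\<gamma> \<in> K"
  using assms(4)
proof (induction "nat \<bar>\<gamma>$2$1\<bar>" arbitrary: \<gamma> rule: less_induct)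
  case less
  note closed = subgroup.m_closed[OF K(1), simplified]
  note T = translation_in_subgroup[OF K(1,3)]
  have m1: "mat (- 1) \<in> K"
    using closed[OF K(2,2)] by (simp only: S_mat_square)
  show ?case
  proof (cases "\<gamma>$2$1 = 0")
    case True
    then have "\<gamma>$1$1 * \<gamma>$2$2 = 1"
      using less.prems by (simp add: carrier_SL2Z_iff)
    then consider "\<gamma>$1$1 = 1" "\<gamma>$2$2 = 1" | "\<gamma>$1$1 = -1" "\<gamma>$2$2 = -1"
      by (auto simp: zmult_eq_1_iff)
    then show ?thesis
    proof cases
      case 1
      then have "\<gamma> = translation (\<gamma>$1$2)"
        using True by (simp add: translation_def matrix_2_simps)
      then show ?thesis
        using T by metis
    next
      case 2
      then have "\<gamma> = mat (- 1) ** translation (- \<gamma>$1$2)"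
        using True by (simp add: translation_def matrix_2_simps)
      then show ?thesis
        using closed[OF m1 T] by metis
    qed
  next
    case False
    define q where "q = \<gamma>$1$1 div \<gamma>$2$1"
    define \<delta> where "\<delta> = S_mat ** translation (- q) ** \<gamma>"
    have "\<delta>$2$1 = \<gamma>$1$1 mod \<gamma>$2$1"
      by (simp add: \<delta>_def q_def S_mat_def translation_def matrix_2_simps minus_div_mult_eq_mod[symmetric])
    then have "nat \<bar>\<delta>$2$1\<bar> < nat \<bar>\<gamma>$2$1\<bar>"
      using abs_mod_less[OF False, of "\<gamma>$1$1"] by (simp add: False)
    moreover have "\<delta> \<in> carrier SL2Z"
      unfolding \<delta>_def using SL2Z.m_closed S_mat_carrier translation_carrier less.prems
      by (metis SL2Z_simps(1))
    ultimately have "\<delta> \<in> K"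
      by (rule less.hyps)
    \<comment> \<open>The inverse of S is -S, because S^2 = -I.\<close>
    moreover have "\<gamma> = translation q ** (mat (- 1) ** S_mat) ** \<delta>"
      by (simp add: \<delta>_def S_mat_def translation_def matrix_2_simps algebra_simps)
    ultimately show ?thesis
      using closed T K m1 by metis
  qed
qed

section \<open>The transformation law\<close>

lemma modular_action_altdef:
  "modular_action \<gamma> \<tau> = (of_int (\<gamma>$1$1) * \<tau> + of_int (\<gamma>$1$2)) / autfactor \<gamma> \<tau>"
  by (simp add: modular_action_def moebius_def autfactor_def)

lemma autfactor_nonzero:
  assumes "\<gamma> \<in> carrier SL2Z" "\<tau> \<in> upper_half_plane"
  shows "autfactor \<gamma> \<tau> \<noteq> 0"
  using assms by (cases "\<gamma>$2$1 = 0")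
    (auto simp: autfactor_def carrier_SL2Z_iff upper_half_plane_def complex_eq_iff)

text \<open>The imaginary part of \<gamma>\<tau> is det(\<gamma>) Im \<tau> / |c\<tau> +
  d|^2.\<close>

lemma modular_action_upper_half_plane:
  assumes "\<gamma> \<in> carrier SL2Z" "\<tau> \<in> upper_half_plane"
  shows "modular_action \<gamma> \<tau> \<in> upper_half_plane"
proof -
  let ?w = "autfactor \<gamma> \<tau>"
  have "Im (modular_action \<gamma> \<tau>) =
      of_int (\<gamma>$1$1 * \<gamma>$2$2 - \<gamma>$1$2 * \<gamma>$2$1) * Im \<tau> / ((Re ?w)\<^sup>2 + (Im ?w)\<^sup>2)"
    unfolding modular_action_altdef Im_divide
    by (rule arg_cong2[of _ _ _ _ divide]) (simp_all add: autfactor_def algebra_simps)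
  also have "\<gamma>$1$1 * \<gamma>$2$2 - \<gamma>$1$2 * \<gamma>$2$1 = 1"
    using assms(1) by (simp add: carrier_SL2Z_iff)
  finally have "Im (modular_action \<gamma> \<tau>) = Im \<tau> / ((Re ?w)\<^sup>2 + (Im ?w)\<^sup>2)"
    by simp
  moreover have "(Re ?w)\<^sup>2 + (Im ?w)\<^sup>2 > 0"
    using autfactor_nonzero[OF assms] by (auto simp: complex_eq_iff sum_power2_gt_zero_iff)
  ultimately show ?thesis
    using assms(2) by (simp add: upper_half_plane_def)
qed

text \<open>The cocycle identity. It makes the lifted action multiplicative and makes the eta law
  pass to products of matrices.\<close>

lemma autfactor_mult:
  assumes "\<delta> \<in> carrier SL2Z" "\<tau> \<in> upper_half_plane"
  shows "autfactor (\<gamma> ** \<delta>) \<tau> = autfactor \<gamma> (modular_action \<delta> \<tau>) * autfactor \<delta> \<tau>"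
  using autfactor_nonzero[OF assms] unfolding modular_action_altdef
  by (simp add: autfactor_def[of \<gamma>] autfactor_def[of "\<gamma> ** \<delta>"] distrib_right)
     (simp add: autfactor_def matrix_mult_2 algebra_simps)

lemma modular_action_mult:
  assumes "\<gamma> \<in> carrier SL2Z" "\<delta> \<in> carrier SL2Z" "\<tau> \<in> upper_half_plane"
  shows "modular_action (\<gamma> ** \<delta>) \<tau> = modular_action \<gamma> (modular_action \<delta> \<tau>)"
proof -
  let ?w = "autfactor \<delta> \<tau>" and ?\<sigma> = "modular_action \<delta> \<tau>"
  have w: "?w \<noteq> 0"
    by (rule autfactor_nonzero) fact+
  have "(of_int (\<gamma>$1$1) * ?\<sigma> + of_int (\<gamma>$1$2)) * ?w =
      of_int ((\<gamma> ** \<delta>)$1$1) * \<tau> + of_int ((\<gamma> ** \<delta>)$1$2)"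
    using w unfolding modular_action_altdef[of \<delta>]
    by (simp add: distrib_right) (simp add: autfactor_def matrix_mult_2 algebra_simps)
  then show ?thesis
    unfolding modular_action_altdef[of "\<gamma> ** \<delta>"] modular_action_altdef[of \<gamma>]
      autfactor_mult[OF assms(2,3)]
    using w by (metis mult_divide_mult_cancel_right)
qed

lemma autfactor_mat [simp]: "autfactor (mat z) \<tau> = of_int z"
  by (simp add: autfactor_def mat_2)

lemma modular_action_one [simp]: "modular_action (mat 1) \<tau> = \<tau>"
  by (simp add: modular_action_altdef mat_2)

lemma holomorphic_autfactor: "autfactor \<gamma> holomorphic_on A"
  unfolding autfactor_def[abs_def] by (intro holomorphic_intros)

section \<open>Characters of the modular group\<close>

lemma hom_nonzero_complexD:
  assumes "c \<in> hom SL2Z nonzero_complex"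
  shows "\<gamma> \<in> carrier SL2Z \<Longrightarrow> c \<gamma> \<noteq> 0"
    and "\<gamma> \<in> carrier SL2Z \<Longrightarrow> \<delta> \<in> carrier SL2Z \<Longrightarrow> c (\<gamma> ** \<delta>) = c \<gamma> * c \<delta>"
    and "c (mat 1) = 1"
proof -
  show nz: "c \<gamma> \<noteq> 0" if "\<gamma> \<in> carrier SL2Z" for \<gamma>
    using assms that by (auto simp: hom_def nonzero_complex_def)
  show mult: "c (\<gamma> ** \<delta>) = c \<gamma> * c \<delta>" if "\<gamma> \<in> carrier SL2Z" "\<delta> \<in> carrier SL2Z" for \<gamma> \<delta>
    using assms that by (auto simp: hom_def nonzero_complex_def)
  show "c (mat 1) = 1"
    using mult[of "mat 1" "mat 1"] nz[of "mat 1"] SL2Z.one_closed by simp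
qed

lemma hom_inv_eq_inverse:
  assumes "c \<in> hom SL2Z nonzero_complex" "\<gamma> \<in> carrier SL2Z"
  shows "c (inv\<^bsub>SL2Z\<^esub> \<gamma>) = inverse (c \<gamma>)"
proof -
  have "c \<gamma> * c (inv\<^bsub>SL2Z\<^esub> \<gamma>) = 1"
    using hom_nonzero_complexD[OF assms(1)] assms(2) SL2Z.r_inv SL2Z.inv_closed by (metis SL2Z_simps)
  then show ?thesis
    by (metis inverse_unique)
qed

text \<open>The matrices with this property form a subgroup containing both generators. Consequently
  the summand 12t in the exponent of eta changes the weight but not the character.\<close>

lemma eta_squared_character_power_12:
  assumes "eta_squared_character chi" "\<gamma> \<in> carrier SL2Z"
  shows "chi \<gamma> ^ 12 = 1"
proof -
  have hom: "chi \<in> hom SL2Z nonzero_complex"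
    and T: "chi T_mat = exp (2 * of_real pi * \<i> / 12)" and S: "chi S_mat = - \<i>"
    using assms(1) by (simp_all add: eta_squared_character_def)
  have "\<gamma> \<in> {\<gamma> \<in> carrier SL2Z. chi \<gamma> ^ 12 = 1}"
  proof (rule SL2Z_generated[OF _ _ _ assms(2)])
    show "subgroup {\<gamma> \<in> carrier SL2Z. chi \<gamma> ^ 12 = 1} SL2Z"
      using SL2Z.m_closed SL2Z.one_closed
      by unfold_locales
         (auto simp: hom_nonzero_complexD[OF hom] hom_inv_eq_inverse[OF hom] power_mult_distrib power_inverse)
    show "S_mat \<in> {\<gamma> \<in> carrier SL2Z. chi \<gamma> ^ 12 = 1}"
    proof -
      have "(- \<i>) ^ 12 = ((- \<i>) ^ 2) ^ 6"
        by (simp flip: power_mult)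
      then show ?thesis
        by (simp add: S)
    qed
    show "T_mat \<in> {\<gamma> \<in> carrier SL2Z. chi \<gamma> ^ 12 = 1}"
    proof -
      have "exp (2 * of_real pi * \<i> / 12) ^ 12 = exp (2 * of_real pi * \<i>)"
        unfolding exp_of_nat_mult[symmetric] by (rule arg_cong[of _ _ exp]) simp
      then show ?thesis
        by (simp only: mem_Collect_eq T exp_two_pi_i T_mat_carrier simp_thms)
    qed
  qed
  then show ?thesis
    by simp
qed

text \<open>The matrices satisfying the law at every point of the half-plane form a subgroup, by the
  cocycle identity and multiplicativity of \<chi>. It contains S by the inversion law and T by the
  translation law.\<close>

lemma dedekind_eta_transformation:
  assumes "eta_squared_character chi" "\<gamma> \<in> carrier SL2Z" "\<tau> \<in> upper_half_plane"
  shows "dedekind_eta (modular_action \<gamma> \<tau>) ^ 2 = autfactor \<gamma> \<tau> * chi \<gamma> * dedekind_eta \<tau> ^ 2"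
proof -
  have hom: "chi \<in> hom SL2Z nonzero_complex"
    and T: "chi T_mat = exp (2 * of_real pi * \<i> / 12)" and S: "chi S_mat = - \<i>"
    using assms(1) by (simp_all add: eta_squared_character_def)
  define K where "K = {\<gamma> \<in> carrier SL2Z. \<forall>\<tau>\<in>upper_half_plane.
    dedekind_eta (modular_action \<gamma> \<tau>) ^ 2 = autfactor \<gamma> \<tau> * chi \<gamma> * dedekind_eta \<tau> ^ 2}"
  have "\<gamma> \<in> K"
  proof (rule SL2Z_generated[OF _ _ _ assms(2)])
    show "subgroup K SL2Z"
    proof
      show "K \<subseteq> carrier SL2Z"
        by (auto simp: K_def)
      show "\<one>\<^bsub>SL2Z\<^esub> \<in> K"
        using SL2Z.one_closed by (simp add: K_def hom_nonzero_complexD[OF hom])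
    next
      fix \<gamma> \<delta> assume "\<gamma> \<in> K" "\<delta> \<in> K"
      then show "\<gamma> \<otimes>\<^bsub>SL2Z\<^esub> \<delta> \<in> K"
        using SL2Z.m_closed[of \<gamma> \<delta>]
        by (simp add: K_def modular_action_mult autfactor_mult modular_action_upper_half_plane hom_nonzero_complexD[OF hom])
    next
      fix \<gamma> assume \<gamma>: "\<gamma> \<in> K"
      let ?\<delta> = "inv\<^bsub>SL2Z\<^esub> \<gamma>"
      have car: "\<gamma> \<in> carrier SL2Z" "?\<delta> \<in> carrier SL2Z"
        using \<gamma> by (auto simp: K_def)
      have "dedekind_eta (modular_action ?\<delta> \<tau>) ^ 2 = autfactor ?\<delta> \<tau> * chi ?\<delta> * dedekind_eta \<tau> ^ 2"
        if \<tau>: "\<tau> \<in> upper_half_plane" for \<tau>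
      proof -
        have one: "\<gamma> ** ?\<delta> = mat 1"
          using SL2Z.r_inv[OF car(1)] by simp
        let ?\<sigma> = "modular_action ?\<delta> \<tau>"
        have \<sigma>: "?\<sigma> \<in> upper_half_plane"
          by (rule modular_action_upper_half_plane[OF car(2) \<tau>])
        have "modular_action \<gamma> ?\<sigma> = \<tau>"
          using modular_action_mult[OF car \<tau>] by (simp add: one)
        moreover have j: "autfactor \<gamma> ?\<sigma> * autfactor ?\<delta> \<tau> = 1"
          using autfactor_mult[OF car(2) \<tau>, of \<gamma>] by (simp add: one)
        \<comment> \<open>The law for \<gamma> at the point \<open>?\<sigma>\<close>, which \<gamma>
          sends to \<tau>; solving it for the value at \<open>?\<sigma>\<close> gives the law for
          the inverse.\<close>
        ultimately have "dedekind_eta \<tau> ^ 2 = autfactor \<gamma> ?\<sigma> * chi \<gamma> * dedekind_eta ?\<sigma> ^ 2"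
          using \<gamma> \<sigma> by (auto simp: K_def)
        then have "autfactor ?\<delta> \<tau> * chi ?\<delta> * dedekind_eta \<tau> ^ 2 =
            (autfactor \<gamma> ?\<sigma> * autfactor ?\<delta> \<tau>) * (chi \<gamma> * inverse (chi \<gamma>)) * dedekind_eta ?\<sigma> ^ 2"
          by (simp add: hom_inv_eq_inverse[OF hom car(1)])
        then show ?thesis
          using hom_nonzero_complexD(1)[OF hom car(1)] j by simp
      qed
      then show "?\<delta> \<in> K"
        using car by (simp add: K_def)
    qed
    have action: "modular_action S_mat \<tau> = - 1 / \<tau>" "autfactor S_mat \<tau> = \<tau>"
      "modular_action T_mat \<tau> = \<tau> + 1" "autfactor T_mat \<tau> = 1" for \<tau>
      by (simp_all add: modular_action_altdef autfactor_def S_mat_def T_mat_def)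
    have "dedekind_eta (modular_action S_mat \<tau>) ^ 2 = autfactor S_mat \<tau> * chi S_mat * dedekind_eta \<tau> ^ 2"
      if "\<tau> \<in> upper_half_plane" for \<tau>
      unfolding action S dedekind_eta_inversion[OF that] by simp
    then show "S_mat \<in> K"
      by (simp add: K_def)
    show "T_mat \<in> K"
      by (simp add: K_def action T dedekind_eta_translation)
  qed
  then show ?thesis
    using assms(3) by (simp add: K_def)
qed

section \<open>Line bundles on the compactified modular orbifold\<close>

lemma mat_smult_vec [simp]: "mat z *v v = z *s v"
  for z :: "'a::comm_semiring_1"
  by (simp add: vec_eq_iff matrix_vector_mult_def mat_def if_distrib[where f = "\<lambda>x. x * y" for y] cong: if_cong)

lemma mat_mult_mat: "mat w ** mat z = mat (w * z)"
  for w z :: "'a::comm_semiring_1"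
  by (simp add: vec_eq_iff matrix_matrix_mult_def mat_def if_distrib[where f = "\<lambda>x. x * y" for y] cong: if_cong)

lemma invertible_mat:
  fixes z :: "'a::field"
  assumes "z \<noteq> 0"
  shows "invertible (mat z :: 'a^'n^'n)"
  unfolding invertible_def
  by (rule exI[of _ "mat (inverse z)"]) (simp add: mat_mult_mat assms)

text \<open>Powers of scalar matrices are scalar, and \<open>mat\<close> is bounded linear, so it
  commutes with the exponential series.\<close>

lemma matrix_exp_mat: "matrix_exp (mat z :: complex^'n^'n) = mat (exp z)"
proof -
  have pow: "((**) (mat z) ^^ j) (mat 1) = (mat (z ^ j) :: complex^'n^'n)" for j
    by (induction j) (simp_all add: mat_mult_mat)
  have "linear (mat :: complex \<Rightarrow> complex^'n^'n)"
    by (rule linearI) (simp_all add: vec_eq_iff mat_def)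
  then have blin: "bounded_linear (mat :: complex \<Rightarrow> complex^'n^'n)"
    by (simp add: linear_conv_bounded_linear)
  have "matrix_exp (mat z :: complex^'n^'n) = (\<Sum>j. mat (z ^ j /\<^sub>R fact j))"
    unfolding matrix_exp_def pow
    by (simp add: linear_scale[OF \<open>linear mat\<close>] inverse_eq_divide)
  also have "\<dots> = mat (\<Sum>j. z ^ j /\<^sub>R fact j)"
    by (rule bounded_linear.suminf[OF blin summable_exp_generic, symmetric])
  finally show ?thesis
    by (simp add: exp_def)
qed

lemma exp_scaled_mat: "exp_scaled z (mat l) = mat (exp (2 * of_real pi * \<i> * z * l))"
  by (simp add: exp_scaled_def mat_mult_mat matrix_exp_mat)

text \<open>Every action, gluing map and isomorphism below is multiplication by a nonvanishing
  holomorphic function, so this criterion covers them all.\<close>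

lemma bundle_iso_over_scalarI:
  fixes F :: "'n::finite total \<Rightarrow> 'n total"
  assumes "g holomorphic_on X" "\<And>x. x \<in> X \<Longrightarrow> g x \<noteq> 0"
    and "\<And>x v. x \<in> X \<Longrightarrow> F (v, x) = (g x *s v, f x)"
  shows "bundle_iso_over X f F"
  unfolding bundle_iso_over_def
proof (intro exI[of _ "\<lambda>x. mat (g x)"] conjI allI ballI)
  show "(\<lambda>x. (mat (g x) :: complex^'n^'n) $ i $ j) holomorphic_on X" for i j
    using assms(1) by (cases "i = j") (simp_all add: mat_def)
qed (simp_all add: assms invertible_mat)

section \<open>The cusp group and the gluing condition\<close>

text \<open>The upper triangular matrices form a subgroup containing both generators, and
  determinant 1 forces equal diagonal entries 1 or -1.\<close>

lemma cusp_group_cases: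
  assumes "\<gamma> \<in> cusp_group"
  obtains \<epsilon> n where "\<epsilon> \<in> {1, - 1}" "\<gamma> = mat \<epsilon> ** translation n"
proof -
  have "subgroup {\<gamma> \<in> carrier SL2Z. \<gamma>$2$1 = 0} SL2Z"
  proof
    fix \<gamma> assume "\<gamma> \<in> {\<gamma> \<in> carrier SL2Z. \<gamma>$2$1 = 0}"
    then have \<gamma>: "\<gamma> \<in> carrier SL2Z" "\<gamma>$2$1 = 0" "\<gamma>$2$2 \<noteq> 0"
      by (auto simp: carrier_SL2Z_iff)
    have "(inv\<^bsub>SL2Z\<^esub> \<gamma> ** \<gamma>)$2$1 = 0" "\<gamma>$1$1 \<noteq> 0"
      using SL2Z.l_inv[OF \<gamma>(1)] \<gamma> by (auto simp: mat_2 carrier_SL2Z_iff)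
    then show "inv\<^bsub>SL2Z\<^esub> \<gamma> \<in> {\<gamma> \<in> carrier SL2Z. \<gamma>$2$1 = 0}"
      using \<gamma> by (simp add: matrix_mult_2)
  qed (use SL2Z.m_closed SL2Z.one_closed in \<open>auto simp: matrix_2_simps\<close>)
  then have "cusp_group \<subseteq> {\<gamma> \<in> carrier SL2Z. \<gamma>$2$1 = 0}"
    unfolding cusp_group_def
    by (intro SL2Z.generate_subgroup_incl) (auto simp: minus_one_carrier mat_2 T_mat_def[THEN arg_cong[of _ _ "\<lambda>A. A $ 2 $ 1"]])
  then have \<gamma>: "\<gamma>$2$1 = 0" "\<gamma>$1$1 * \<gamma>$2$2 = 1"
    using assms by (auto simp: carrier_SL2Z_iff)
  then have "\<gamma>$1$1 = \<gamma>$2$2" "\<gamma>$2$2 \<in> {1, - 1}"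
    by (auto simp: zmult_eq_1_iff)
  moreover from this have "\<gamma> = mat (\<gamma>$2$2) ** translation (\<gamma>$2$2 * \<gamma>$1$2)"
    using \<gamma> by (auto simp: translation_def matrix_2_simps)
  ultimately show thesis
    using that by blast
qed

lemma mat_unit_carrier: "\<epsilon> \<in> {1, - 1} \<Longrightarrow> mat \<epsilon> \<in> carrier SL2Z"
  by (auto simp: carrier_SL2Z_iff mat_2)

lemma hom_translation:
  assumes "c \<in> hom SL2Z nonzero_complex" "c T_mat = exp (2 * of_real pi * \<i> * l)"
  shows "c (translation n) = exp (2 * of_real pi * \<i> * of_int n * l)"
proof -
  note c = hom_nonzero_complexD[OF assms(1)]
  have step: "c (translation (n + 1)) = c (translation n) * exp (2 * of_real pi * \<i> * l)" for n
  proof -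
    have "translation (n + 1) = translation n ** T_mat"
      by (simp only: translation_1[symmetric] translation_mult)
    then show ?thesis
      by (simp only: c(2)[OF translation_carrier T_mat_carrier] assms(2))
  qed
  show ?thesis
  proof (induction n rule: int_induct[where k = 0])
    case base
    show ?case
      by (simp add: translation_0 c)
  next
    case (step1 n)
    then show ?case
      by (simp only: step) (simp add: algebra_simps flip: exp_add)
  next
    case (step2 n)
    have "c (translation (n - 1)) * exp (2 * of_real pi * \<i> * l) = exp (2 * of_real pi * \<i> * of_int n * l)"
      using step[of "n - 1"] step2 by simp
    then show ?case
      by (simp add: algebra_simps exp_diff divide_simps)
  qed
qed

lemma exponent_char_rep:
  assumes "c \<in> hom SL2Z nonzero_complex" "c T_mat = exp (2 * of_real pi * \<i> * l)"
  shows "exponent (char_rep c) (mat l)"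
  using hom_nonzero_complexD[OF assms(1)] assms(2)
  by (auto simp: exponent_def exp_scaled_mat char_rep_def hom_def GL_def invertible_mat mat_mult_mat)

text \<open>The lifts are actions by the cocycle identity and multiplicativity of \<open>c\<close>.
  They are compatible with gluing because the cusp group consists of the matrices \<plusminus>T^n,
  on which the value of \<open>c\<close> at T matches the exponent \<open>l\<close>.\<close>

lemma vector_bundle_on_mbar_Vbar:
  fixes l :: complex
  assumes "c \<in> hom SL2Z nonzero_complex" "c T_mat = exp (2 * of_real pi * \<i> * l)"
  shows "vector_bundle_on_mbar (Vbar k (mat l) (char_rep c))" (is "vector_bundle_on_mbar ?E")
proof -
  note c = hom_nonzero_complexD[OF assms(1)]
  have "equivariant_bundle SL2Z upper_half_plane modular_action (act_half_plane ?E)"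
    unfolding equivariant_bundle_def
  proof (intro conjI ballI)
    fix \<gamma> assume \<gamma>: "\<gamma> \<in> carrier SL2Z"
    show "bundle_iso_over upper_half_plane (modular_action \<gamma>) (act_half_plane ?E \<gamma>)"
      by (rule bundle_iso_over_scalarI[where g = "\<lambda>\<tau>. autfactor \<gamma> \<tau> powi k * c \<gamma>"])
         (use \<gamma> in \<open>auto intro!: holomorphic_intros holomorphic_autfactor
            simp: Vbar_def char_rep_def autfactor_nonzero c\<close>)
  next
    fix \<gamma> \<delta> and p :: "1 total"
    assume *: "\<gamma> \<in> carrier SL2Z" "\<delta> \<in> carrier SL2Z" "p \<in> UNIV \<times> upper_half_plane"
    then show "act_half_plane ?E (\<gamma> \<otimes>\<^bsub>SL2Z\<^esub> \<delta>) p = act_half_plane ?E \<gamma> (act_half_plane ?E \<delta> p)"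
      by (auto simp: Vbar_def char_rep_def modular_action_mult autfactor_mult
          power_int_mult_distrib c)
  qed (auto simp: Vbar_def char_rep_def c)
  moreover have "equivariant_bundle C2 unit_disk (\<lambda>_ q. q) (act_disk ?E)"
    unfolding equivariant_bundle_def
  proof (intro conjI ballI)
    fix \<epsilon> assume "\<epsilon> \<in> carrier C2"
    then have \<epsilon>: "\<epsilon> \<in> {1, - 1}"
      by (simp add: C2_def)
    show "bundle_iso_over unit_disk (\<lambda>q. q) (act_disk ?E \<epsilon>)"
      by (rule bundle_iso_over_scalarI[where g = "\<lambda>_. of_int \<epsilon> powi k * c (mat \<epsilon>)"])
         (use \<epsilon> c(1)[OF mat_unit_carrier[OF \<epsilon>]] in \<open>auto simp: Vbar_def char_rep_def\<close>)
  next
    fix \<epsilon> \<delta> and p :: "1 total"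
    assume "\<epsilon> \<in> carrier C2" "\<delta> \<in> carrier C2"
    then have "mat \<epsilon> \<in> carrier SL2Z" "mat \<delta> \<in> carrier SL2Z"
      by (simp_all add: C2_def mat_unit_carrier)
    then have "c (mat (\<epsilon> * \<delta>)) = c (mat \<epsilon>) * c (mat \<delta>)"
      by (metis c(2) mat_mult_mat)
    then show "act_disk ?E (\<epsilon> \<otimes>\<^bsub>C2\<^esub> \<delta>) p = act_disk ?E \<epsilon> (act_disk ?E \<delta> p)"
      by (cases p) (simp add: Vbar_def char_rep_def C2_def power_int_mult_distrib mult_ac)
  qed (auto simp: Vbar_def char_rep_def C2_def c)
  moreover have "bundle_iso_over upper_half_plane nome (glue ?E)"
    by (rule bundle_iso_over_scalarI[where g = "\<lambda>\<tau>. exp (2 * of_real pi * \<i> * (- \<tau>) * l)"])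
       (auto intro!: holomorphic_intros simp: Vbar_def exp_scaled_mat)
  moreover have "glue ?E (act_half_plane ?E \<gamma> p) = act_disk ?E (\<gamma>$2$2) (glue ?E p)"
    if cusp: "\<gamma> \<in> cusp_group" for \<gamma> and p :: "1 total"
  proof -
    obtain v \<tau> where p: "p = (v, \<tau>)"
      by (cases p)
    obtain \<epsilon> n where \<epsilon>: "\<epsilon> \<in> {1, - 1}" and \<gamma>: "\<gamma> = mat \<epsilon> ** translation n"
      using cusp_group_cases[OF cusp] by blast
    have entries: "\<gamma>$2$1 = 0" "\<gamma>$2$2 = \<epsilon>" "\<gamma>$1$1 = \<epsilon>" "\<gamma>$1$2 = \<epsilon> * n"
      by (simp_all add: \<gamma> translation_def matrix_2_simps)
    have action: "modular_action \<gamma> \<tau> = \<tau> + of_int n" "autfactor \<gamma> \<tau> = of_int \<epsilon>"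
      using \<epsilon> by (auto simp: modular_action_altdef autfactor_def entries)
    have nome: "nome (\<tau> + of_int n) = nome \<tau>"
      using exp_integer_2pi[of "of_int n"] by (simp add: nome_def distrib_left exp_add mult_ac)
    define e where "e z = exp (2 * of_real pi * \<i> * z * l)" for z
    have "c \<gamma> = c (mat \<epsilon>) * e (of_int n)"
      by (simp only: \<gamma> c(2)[OF mat_unit_carrier[OF \<epsilon>] translation_carrier] hom_translation[OF assms] e_def)
    \<comment> \<open>The shift of \<tau> by n in the gluing factor is undone by the value of
      \<open>c\<close> at T^n, leaving only the contribution of the sign
      \<open>\<epsilon>\<close>.\<close>
    moreover have "e (- (\<tau> + of_int n)) * e (of_int n) = e (- \<tau>)"
      by (simp add: e_def algebra_simps flip: exp_add)
    ultimately have "e (- (\<tau> + of_int n)) * (of_int \<epsilon> powi k * c \<gamma>) = of_int \<epsilon> powi k * c (mat \<epsilon>) * e (- \<tau>)"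
      by (metis mult.assoc mult.left_commute)
    moreover have "exp_scaled z (mat l) = (mat (e z) :: complex^1^1)" for z
      by (simp add: exp_scaled_mat e_def)
    ultimately show ?thesis
      by (simp add: p action nome entries Vbar_def char_rep_def)
  qed
  ultimately show ?thesis
    by (simp add: vector_bundle_on_mbar_def)
qed

text \<open>Puts the trivial representation in the form of a character with exponent 0, so that the
  results on characters apply to it.\<close>

lemma Lbar_eq_Vbar: "Lbar k = Vbar k (mat 0) (char_rep (\<lambda>_. 1))"
  by (simp add: Lbar_def char_rep_def[abs_def])

text \<open>Here \<open>j\<close> stands for the automorphy factor and \<open>x\<close> for the
  value of \<chi>. The powers of \<open>x\<close> combine to x^(-12t) = 1, so only the weight
  changes, from k to k - m.\<close>

lemma powi_weight_shift:
  fixes j x :: complex and a :: nat and t k :: int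
  assumes "j \<noteq> 0" "x ^ 12 = 1" "m = int a + 12 * t"
  shows "(j * x) powi (- m) * (j powi k * x ^ a) = j powi (k - m)"
proof -
  have "x \<noteq> 0"
    using assms(2) by auto
  have "x powi (- m) = x powi (- int a + 12 * - t)"
    using assms(3) by simp
  also have "\<dots> = x powi (- int a) * (x powi 12) powi (- t)"
    using \<open>x \<noteq> 0\<close> by (simp only: power_int_add power_int_mult simp_thms)
  also have "\<dots> = inverse (x ^ a)"
    using assms(2) by (simp add: power_int_minus)
  finally have "x powi (- m) * x ^ a = 1"
    using \<open>x \<noteq> 0\<close> by simp
  moreover have "j powi (- m) * j powi k = j powi (k - m)"
    using assms(1) by (simp flip: power_int_add)
  ultimately show ?thesis
    by (simp add: power_int_mult_distrib mult_ac)
qed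

text \<open>Canonicity is expressed by naming the half-plane component explicitly; over the
  punctured disk the other component is then forced by the gluing condition.\<close>

theorem theorem3p4:
  fixes chi :: "int^2^2 \<Rightarrow> complex" and a :: nat and t k :: int and L :: "complex^1^1"
  assumes "eta_squared_character chi"
    and "a \<in> {0..11}"
    and "L = mat (of_nat a / 12 + of_int t)"
  shows "exponent (char_rep (\<lambda>\<gamma>. chi \<gamma> ^ a)) L \<and>
    vector_bundle_on_mbar (Vbar k L (char_rep (\<lambda>\<gamma>. chi \<gamma> ^ a))) \<and>
    vector_bundle_on_mbar (Lbar (k - int a - 12 * t)) \<and>
    (\<exists>\<Psi>. mbar_bundle_iso
       (Vbar k L (char_rep (\<lambda>\<gamma>. chi \<gamma> ^ a)))
       (Lbar (k - int a - 12 * t))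
       (\<lambda>(v, \<tau>). ((dedekind_eta \<tau> powi (- 2 * (int a + 12 * t))) *s v, \<tau>)) \<Psi>)"
proof -
  define m where "m = int a + 12 * t"
  define l :: complex where "l = of_nat a / 12 + of_int t"
  have L: "L = mat l" and weight: "k - int a - 12 * t = k - m"
    by (simp_all add: assms(3) l_def m_def)
  have chi: "chi \<in> hom SL2Z nonzero_complex" and T: "chi T_mat = exp (2 * of_real pi * \<i> / 12)"
    and S: "chi S_mat = - \<i>"
    using assms(1) by (simp_all add: eta_squared_character_def)
  have hom: "(\<lambda>\<gamma>. chi \<gamma> ^ a) \<in> hom SL2Z nonzero_complex"
    using chi by (auto simp: hom_def nonzero_complex_def power_mult_distrib)
  \<comment> \<open>The integer t contributes the factor exp(2\<pi>it) = 1, so \<open>l\<close> is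
    an exponent of the a-th power of \<chi> for every t.\<close>
  have "exp (2 * of_real pi * \<i> * l) = exp (2 * of_real pi * \<i> / 12) ^ a * exp (2 * of_real pi * of_int t * \<i>)"
    unfolding exp_of_nat_mult[symmetric] exp_add[symmetric]
    by (rule arg_cong[of _ _ exp]) (simp add: l_def algebra_simps)
  then have T_a: "chi T_mat ^ a = exp (2 * of_real pi * \<i> * l)"
    using exp_integer_2pi[of "of_int t"] by (simp add: T mult_ac)
  have one_hom: "(\<lambda>_. 1) \<in> hom SL2Z nonzero_complex"
    by (simp add: hom_def nonzero_complex_def)
  let ?E = "Vbar k L (char_rep (\<lambda>\<gamma>. chi \<gamma> ^ a))" and ?E' = "Lbar (k - m)"
  let ?\<Phi> = "\<lambda>(v :: complex^1, \<tau>). ((dedekind_eta \<tau> powi (- 2 * m)) *s v, \<tau>)"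
  let ?\<Psi> = "\<lambda>(v :: complex^1, q). ((euler_prod q powi (- 2 * m)) *s v, q)"
  have "bundle_iso_over upper_half_plane (\<lambda>\<tau>. \<tau>) ?\<Phi>"
    by (rule bundle_iso_over_scalarI[where g = "\<lambda>\<tau>. dedekind_eta \<tau> powi (- 2 * m)"])
       (auto intro!: holomorphic_intros holomorphic_dedekind_eta simp: dedekind_eta_nonzero)
  moreover have "?\<Phi> (act_half_plane ?E \<gamma> p) = act_half_plane ?E' \<gamma> (?\<Phi> p)"
    if \<gamma>: "\<gamma> \<in> carrier SL2Z" and p_mem: "p \<in> UNIV \<times> upper_half_plane" for \<gamma> p
  proof -
    obtain v \<tau> where p: "p = (v, \<tau>)" and \<tau>: "\<tau> \<in> upper_half_plane"
      using p_mem by (cases p) auto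
    have "dedekind_eta (modular_action \<gamma> \<tau>) powi (- 2 * m) =
        (autfactor \<gamma> \<tau> * chi \<gamma>) powi (- m) * dedekind_eta \<tau> powi (- 2 * m)"
    proof -
      \<comment> \<open>The transformation law is available for the square of eta, hence the even
        exponent is split.\<close>
      have sq: "z powi (- 2 * m) = (z ^ 2) powi (- m)" for z :: complex
        using power_int_mult[of z 2 "- m"] by simp
      show ?thesis
        unfolding sq dedekind_eta_transformation[OF assms(1) \<gamma> \<tau>] by (rule power_int_mult_distrib)
    qed
    then have "dedekind_eta (modular_action \<gamma> \<tau>) powi (- 2 * m) * (autfactor \<gamma> \<tau> powi k * chi \<gamma> ^ a) =
        autfactor \<gamma> \<tau> powi (k - m) * dedekind_eta \<tau> powi (- 2 * m)"
      unfolding powi_weight_shift[OF autfactor_nonzero[OF \<gamma> \<tau>] eta_squared_character_power_12[OF assms(1) \<gamma>] m_def, symmetric]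
      by (simp only: mult_ac)
    then show ?thesis
      by (simp add: p Lbar_eq_Vbar Vbar_def char_rep_def)
  qed
  ultimately have "equivariant_iso SL2Z upper_half_plane (act_half_plane ?E) (act_half_plane ?E') ?\<Phi>"
    by (simp only: equivariant_iso_def) blast
  moreover have "equivariant_iso C2 unit_disk (act_disk ?E) (act_disk ?E') ?\<Psi>"
    unfolding equivariant_iso_def
  proof (intro conjI ballI)
    show "bundle_iso_over unit_disk (\<lambda>q. q) ?\<Psi>"
      by (rule bundle_iso_over_scalarI[where g = "\<lambda>q. euler_prod q powi (- 2 * m)"])
         (auto intro!: holomorphic_intros holomorphic_euler_prod simp: euler_prod_nonzero)
  next
    fix \<epsilon> and p :: "1 total"
    assume "\<epsilon> \<in> carrier C2"
    then have \<epsilon>: "\<epsilon> = 1 \<or> \<epsilon> = - 1"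
      by (auto simp: C2_def)
    have "chi (mat (- 1)) = - 1"
      using hom_nonzero_complexD(2)[OF chi, of S_mat S_mat] by (simp add: S S_mat_square)
    then have chi_\<epsilon>: "chi (mat \<epsilon>) = of_int \<epsilon>"
      using \<epsilon> hom_nonzero_complexD(3)[OF chi] by auto
    \<comment> \<open>At \<open>mat \<epsilon>\<close> both the automorphy factor and \<chi> equal
      \<open>\<epsilon>\<close>, and their product is 1.\<close>
    have "of_int \<epsilon> powi k * of_int \<epsilon> ^ a = (of_int \<epsilon> :: complex) powi (k - m)"
      using powi_weight_shift[of "of_int \<epsilon>" "of_int \<epsilon>" m a t k] \<epsilon> by (auto simp: m_def)
    then show "?\<Psi> (act_disk ?E \<epsilon> p) = act_disk ?E' \<epsilon> (?\<Psi> p)"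
      by (cases p) (simp add: Lbar_eq_Vbar Vbar_def char_rep_def chi_\<epsilon> mult.commute)
  qed
  moreover have "glue ?E' (?\<Phi> p) = ?\<Psi> (glue ?E p)" for p
  proof -
    obtain v \<tau> where p: "p = (v, \<tau>)"
      by (cases p)
    \<comment> \<open>Since 2m/24 = l, the fractional power of the nome in eta yields exactly the
      gluing factor of the source bundle; the target is glued with factor 1.\<close>
    have "exp (2 * of_real pi * \<i> * \<tau> / 24) powi (- 2 * m) = exp (2 * of_real pi * \<i> * (- \<tau>) * l)"
      unfolding exp_power_int by (rule arg_cong[of _ _ exp]) (simp add: l_def m_def field_simps)
    then have "dedekind_eta \<tau> powi (- 2 * m) = euler_prod (nome \<tau>) powi (- 2 * m) * exp (2 * of_real pi * \<i> * (- \<tau>) * l)"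
      by (simp only: dedekind_eta_euler_prod power_int_mult_distrib mult.commute)
    then show ?thesis
      by (simp add: p L Lbar_eq_Vbar Vbar_def exp_scaled_mat exp_scaled_mat[of _ 0, simplified])
  qed
  ultimately have "mbar_bundle_iso ?E ?E' ?\<Phi> ?\<Psi>"
    by (simp only: mbar_bundle_iso_def) blast
  then show ?thesis
    using exponent_char_rep[OF hom T_a] vector_bundle_on_mbar_Vbar[OF hom T_a]
      vector_bundle_on_mbar_Vbar[OF one_hom, of 0 "k - m"]
    unfolding weight L m_def[symmetric] Lbar_eq_Vbar by auto
qed

end
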